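(* Let $0\le\alpha,r\le d$, $\delta=\frac\pi2\bigl(5\max(\alpha,r)/d+h^2\bigr)$, and $0<h\le1$ such that $$\{h(2^n-1):n\in\mathbb N\}\cap\bigl((0,\delta)\cup(\pi-\delta,\pi+\delta]\bigr)=\emptyset.$$ Let $x\in D_\alpha$ and $v\sim\gamma$. Then, in the event $E_{\alpha,r}\cap A_{\mathrm{index}}(x)$, where $$E_{\alpha,r}=\Bigl\{v\,:\,\max\bigl(\,\bigl||v|^2-d\bigr|,\ \sup_{y\in D_\alpha}|y\cdot v|\,\bigr)\le r\Bigr\},$$ $$A_{\mathrm{index}}(x)=\Bigl\{W\le|I|\min_{i\in I}e^{-(H\circ\Phi_h^i-H)(x,v)}\Bigl(\sum_{i\in I}e^{-(H\circ\Phi_h^i-H)(x,v)}\Bigr)^{-1}\Bigr\},$$ NUTS simplifies to Uniform HMC with fixed index orbit length $2^{\min(k_\ast,k_{\max})}$, i.e. $$\pi_{\mathrm{NUTS}}(x,\cdot)\,\mathbf 1_{E_{\alpha,r}\cap A_{\mathrm{index}}(x)}=\pi_{\mathrm{UnifHMC}}(x,\cdot)\,\mathbf 1_{E_{\alpha,r}\cap A_{\mathrm{index}}(x)},$$ where $k_\ast$ is the unique integer such that $h(2^{k_\ast}-1)\in(\pi+\delta,2\pi-\delta)$. Furthermore, the rejection probability is bounded by $$\mathbb P\bigl((E_{\alpha,r}\cap A_{\mathrm{index}}(x))^c\bigr)\ \le\ 4\,e^{-r^2/(8d)}+h^2\max(\alpha,r)+\tfrac14h^4d.$$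
   Context: $k_{\max}\in\mathbb N$ is the maximal number of doublings. $\gamma$ is the standard Gaussian measure on $\mathbb R^d$, $D_\alpha=\{x\in\mathbb R^d: \bigl||x|^2-d\bigr|\le\alpha\}$. In $A_{\mathrm{index}}(x)$, $I$ is the index orbit selected in the transition from $x$ with velocity $v$, and $W\sim\mathrm{Unif}([0,1])$ is an independent uniform random variable. Leapfrog. The target is $\gamma$, $H(x,v)=\tfrac12|x|^2+\tfrac12|v|^2$. One leapfrog step of size $h$ is $\Phi_h(x,v)=(x',v')$ with $x'=(1-h^2/2)x+hv$, $v'=v-\tfrac h2(x+x')$; $\Phi_h^L$, $L\in\mathbb Z$, is its $L$-th iterate (negative $L$: iterates of the inverse). $\Pi(x,v)=x$. Index orbits and U-turns. An index orbit is a set $I\subset\mathbb Z$ of consecutive integers whose length $|I|$ is a power of two ($1,2,4,\dots$); $\mathfrak I_0(k)$ is the collection of index orbits of length $2^k$ containing $0$. Given $(x,v)$, $I$ has the U-turn property if $v_+\cdot(x_+-x_-)<0$ or $v_-\cdot(x_+-x_-)<0$, where $(x_+,v_+)=\Phi_h^{\max I}(x,v)$, $(x_-,v_-)=\Phi_h^{\min I}(x,v)$. An index orbit $I$ of length $2^k$ has the sub-U-turn property if at least one of the index orbits obtained by iteratively halving $I$, namely $I_{j,m}=\{i\in I:\min I+m2^{-j}|I|\le i<\min I+(m+1)2^{-j}|I|\}$, $0\le j\le k$, $0\le m\le 2^j-1$, has the U-turn property. Orbit selection. Start with $I_0=\{0\}$. Given the current orbit $I_j$, draw $I'$ uniformly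 from $\{I_j-|I_j|,I_j+|I_j|\}$ (translates). If $I'$ has the sub-U-turn property, stop and select $I_j$. Otherwise set $I_{j+1}=I_j\cup I'$; if $I_{j+1}$ has the U-turn property or $|I_{j+1}|=2^{k_{\max}}$, stop and select $I_{j+1}$; else repeat with $I_{j+1}$. $\mathcal O(x,v)$ is the law of the selected orbit. Kernels. $X\sim\pi_{\mathrm{NUTS}}(x,\cdot)$: draw $v\sim\gamma$, $I\sim\mathcal O(x,v)$, then $L\in I$ with $\mathbb P(L=i)\propto e^{-(H\circ\Phi_h^i-H)(x,v)}$, $i\in I$; output $X=\Pi(\Phi_h^L(x,v))$. Uniform HMC $\pi_{\mathrm{UnifHMC}}$ with index orbit length $2^k$: draw $v\sim\gamma$, $I\sim\mathrm{Unif}(\mathfrak I_0(k))$, then $L\sim\mathrm{Unif}(I)$; output $X=\Pi(\Phi_h^L(x,v))$. The notation $\pi(x,\cdot)\mathbf 1_A=\pi'(x,\cdot)\mathbf 1_A$ means that, in the event $A$, the transition of $\pi$ from $x$ follows the kernel $\pi'$: transitions $X\sim\pi(x,\cdot)$ and $X'\sim\pi'(x,\cdot)$ can be realized on a common probability space carrying the event $A$ (here with the same velocity $v$) such that $X=X'$ on $A$.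
   Formalization: The rejection bound is for the event max(||v|²−d|, |x·v|) ≤ r at the starting point x, since E with the sup over D_α is empty under the hypotheses; the kernel identity is given on both events, for any k_* with the stated property, as such k_* need not exist. *)

theory Defs
  imports "HOL-Probability.Probability"
begin

definition std_gaussian :: "'a::euclidean_space measure" where
  "std_gaussian =
     density lborel (\<lambda>v. ennreal (exp (- (norm v)\<^sup>2 / 2) / sqrt (2 * pi) ^ DIM('a)))"

definition shell :: "real \<Rightarrow> 'a::euclidean_space set" where
  "shell \<alpha> = {x. \<bar>(norm x)\<^sup>2 - real DIM('a)\<bar> \<le> \<alpha>}"

definition energy :: "'a::euclidean_space \<times> 'a \<Rightarrow> real" where
  "energy = (\<lambda>(x, v). (norm x)\<^sup>2 / 2 + (norm v)\<^sup>2 / 2)"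

definition leapfrog :: "real \<Rightarrow> 'a::euclidean_space \<times> 'a \<Rightarrow> 'a \<times> 'a" where
  "leapfrog h = (\<lambda>(x, v).
     let x' = (1 - h\<^sup>2 / 2) *\<^sub>R x + h *\<^sub>R v
     in (x', v - (h / 2) *\<^sub>R (x + x')))"

definition leapfrog_iter :: "real \<Rightarrow> int \<Rightarrow> 'a::euclidean_space \<times> 'a \<Rightarrow> 'a \<times> 'a" where
  "leapfrog_iter h L =
     (if 0 \<le> L then leapfrog h ^^ nat L else inv (leapfrog h) ^^ nat (- L))"

definition index_orbits0 :: "nat \<Rightarrow> int set set" where
  "index_orbits0 k = {I. (\<exists>a. I = {a ..< a + 2 ^ k}) \<and> 0 \<in> I}"

definition uturn :: "real \<Rightarrow> 'a::euclidean_space \<times> 'a \<Rightarrow> int set \<Rightarrow> bool" where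
  "uturn h z I \<longleftrightarrow>
     (let (xp, vp) = leapfrog_iter h (Max I) z;
          (xm, vm) = leapfrog_iter h (Min I) z
      in vp \<bullet> (xp - xm) < 0 \<or> vm \<bullet> (xp - xm) < 0)"

definition suborbit :: "int set \<Rightarrow> nat \<Rightarrow> nat \<Rightarrow> int set" where
  "suborbit I j m =
     {i \<in> I. real_of_int (Min I) + real m * real (card I) / 2 ^ j \<le> real_of_int i \<and>
             real_of_int i < real_of_int (Min I) + real (m + 1) * real (card I) / 2 ^ j}"

definition sub_uturn :: "real \<Rightarrow> 'a::euclidean_space \<times> 'a \<Rightarrow> int set \<Rightarrow> bool" where
  "sub_uturn h z I \<longleftrightarrow>
     (\<exists>k j m. card I = 2 ^ k \<and> j \<le> k \<and> m < 2 ^ j \<and> uturn h z (suborbit I j m))"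

text \<open>
  The natural number counts the doublings that are still allowed. Since the \<open>j\<close>-th orbit has
  \<open>2 ^ j\<close> elements, this counter reaches \<open>0\<close> exactly when the orbit has reached
  length \<open>2 ^ kmax\<close>.
\<close>

primrec select_orbit ::
    "real \<Rightarrow> 'a::euclidean_space \<times> 'a \<Rightarrow> nat \<Rightarrow> int set \<Rightarrow> int set pmf" where
  "select_orbit h z 0 I = return_pmf I"
| "select_orbit h z (Suc n) I =
     bind_pmf (pmf_of_set {(\<lambda>i. i - int (card I)) ` I, (\<lambda>i. i + int (card I)) ` I})
       (\<lambda>I'. if sub_uturn h z I' then return_pmf I
             else if uturn h z (I \<union> I') then return_pmf (I \<union> I')
             else select_orbit h z n (I \<union> I'))"

definition orbit_law :: "real \<Rightarrow> nat \<Rightarrow> 'a::euclidean_space \<times> 'a \<Rightarrow> int set pmf" where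
  "orbit_law h kmax z = select_orbit h z kmax {0}"

definition index_weight :: "real \<Rightarrow> 'a::euclidean_space \<times> 'a \<Rightarrow> int \<Rightarrow> real" where
  "index_weight h z i = exp (- (energy (leapfrog_iter h i z) - energy z))"

definition index_pmf :: "real \<Rightarrow> 'a::euclidean_space \<times> 'a \<Rightarrow> int set \<Rightarrow> int pmf" where
  "index_pmf h z I =
     embed_pmf (\<lambda>i. if i \<in> I then index_weight h z i / (\<Sum>j\<in>I. index_weight h z j) else 0)"

text \<open>Joint law of the orbit \<open>I\<close> and the index \<open>L\<close>, given the velocity.\<close>

definition nuts_choice ::
    "real \<Rightarrow> nat \<Rightarrow> 'a::euclidean_space \<Rightarrow> 'a \<Rightarrow> (int set \<times> int) pmf" where
  "nuts_choice h kmax x v =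
     bind_pmf (orbit_law h kmax (x, v)) (\<lambda>I. map_pmf (Pair I) (index_pmf h (x, v) I))"

definition unif_choice :: "nat \<Rightarrow> (int set \<times> int) pmf" where
  "unif_choice k =
     bind_pmf (pmf_of_set (index_orbits0 k)) (\<lambda>I. map_pmf (Pair I) (pmf_of_set I))"

abbreviation draw_space :: "('a::euclidean_space \<times> int set \<times> int) measure" where
  "draw_space \<equiv> borel \<Otimes>\<^sub>M count_space UNIV \<Otimes>\<^sub>M count_space UNIV"

text \<open>Joint law of velocity, orbit and index, \<open>(v, I, L)\<close>.\<close>

definition draw_law ::
    "('a \<Rightarrow> (int set \<times> int) pmf) \<Rightarrow> ('a::euclidean_space \<times> int set \<times> int) measure" where
  "draw_law C =
     Giry_Monad.bind std_gaussian
       (\<lambda>v. distr (measure_pmf (C v)) draw_space (\<lambda>(I, L). (v, I, L)))"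

abbreviation nuts_draws ::
    "real \<Rightarrow> nat \<Rightarrow> 'a::euclidean_space \<Rightarrow> ('a \<times> int set \<times> int) measure" where
  "nuts_draws h kmax x \<equiv> draw_law (nuts_choice h kmax x)"

abbreviation unif_draws :: "nat \<Rightarrow> ('a::euclidean_space \<times> int set \<times> int) measure" where
  "unif_draws k \<equiv> draw_law (\<lambda>_. unif_choice k)"

definition endpoint :: "real \<Rightarrow> 'a::euclidean_space \<Rightarrow> 'a \<Rightarrow> int \<Rightarrow> 'a" where
  "endpoint h x v L = fst (leapfrog_iter h L (x, v))"

definition nuts_kernel :: "real \<Rightarrow> nat \<Rightarrow> 'a::euclidean_space \<Rightarrow> 'a measure" where
  "nuts_kernel h kmax x = distr (nuts_draws h kmax x) borel (\<lambda>(v, I, L). endpoint h x v L)"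

definition unif_hmc_kernel :: "real \<Rightarrow> nat \<Rightarrow> 'a::euclidean_space \<Rightarrow> 'a measure" where
  "unif_hmc_kernel h k x = distr (unif_draws k) borel (\<lambda>(v, I, L). endpoint h x v L)"

text \<open>
  Joint law of \<open>((v, I), W)\<close>: the velocity and the orbit selected in the NUTS transition from
  \<open>x\<close>, together with a uniform \<open>W\<close> independent of both.
\<close>

definition nuts_selection_law ::
    "real \<Rightarrow> nat \<Rightarrow> 'a::euclidean_space \<Rightarrow> (('a \<times> int set) \<times> real) measure" where
  "nuts_selection_law h kmax x =
     distr (nuts_draws h kmax x) (borel \<Otimes>\<^sub>M count_space UNIV) (\<lambda>(v, I, L). (v, I))
     \<Otimes>\<^sub>M uniform_measure lborel {0..1}"

definition index_level :: "real \<Rightarrow> 'a::euclidean_space \<Rightarrow> 'a \<Rightarrow> int set \<Rightarrow> real" where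
  "index_level h x v I =
     real (card I) * (MIN i\<in>I. index_weight h (x, v) i) * inverse (\<Sum>i\<in>I. index_weight h (x, v) i)"

definition good_event ::
    "real \<Rightarrow> 'a::euclidean_space \<Rightarrow> 'a set \<Rightarrow> (('a \<times> int set) \<times> real) set" where
  "good_event h x E = {((v, I), w). v \<in> E \<and> w \<le> index_level h x v I}"

text \<open>
  Two versions of the velocity event. The supremum in the first one equals
  \<open>sqrt (d + \<alpha>) * norm v\<close>, so the event is empty unless \<open>r\<close> is comparable to \<open>d\<close>; the second
  one only controls the inner product with the starting point \<open>x\<close>.
\<close>

definition velocity_event_sup :: "real \<Rightarrow> real \<Rightarrow> 'a::euclidean_space set" where
  "velocity_event_sup \<alpha> r =
     {v. max \<bar>(norm v)\<^sup>2 - real DIM('a)\<bar> (SUP y\<in>shell \<alpha>. \<bar>y \<bullet> v\<bar>) \<le> r}"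

definition velocity_event :: "real \<Rightarrow> 'a::euclidean_space \<Rightarrow> 'a set" where
  "velocity_event r x = {v. max \<bar>(norm v)\<^sup>2 - real DIM('a)\<bar> \<bar>x \<bullet> v\<bar> \<le> r}"

lemma velocity_event_sup_subset:
  fixes x :: "'a::euclidean_space"
  assumes "x \<in> shell \<alpha>"
  shows "velocity_event_sup \<alpha> r \<subseteq> velocity_event r x"
proof
  fix v :: 'a assume v: "v \<in> velocity_event_sup \<alpha> r"
  have "bdd_above ((\<lambda>y. \<bar>y \<bullet> v\<bar>) ` shell \<alpha>)"
  proof (rule bdd_aboveI2)
    fix y :: 'a assume "y \<in> shell \<alpha>"
    then have "(norm y)\<^sup>2 \<le> real DIM('a) + \<alpha>"
      by (auto simp: shell_def)
    then have "norm y \<le> sqrt (real DIM('a) + \<alpha>)"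
      by (rule real_le_rsqrt)
    then show "\<bar>y \<bullet> v\<bar> \<le> sqrt (real DIM('a) + \<alpha>) * norm v"
      using Cauchy_Schwarz_ineq2[of y v] by (meson mult_right_mono norm_ge_zero order_trans)
  qed
  then have "\<bar>x \<bullet> v\<bar> \<le> (SUP y\<in>shell \<alpha>. \<bar>y \<bullet> v\<bar>)"
    using assms by (rule cSUP_upper2) simp_all
  then show "v \<in> velocity_event r x"
    using v by (simp add: velocity_event_sup_def velocity_event_def)
qed

text \<open>
  NUTS from \<open>x\<close> follows Uniform HMC with orbit length \<open>2 ^ k\<close> on the event \<open>A\<close>: both transitions
  are realized on one probability space, with the same velocity \<open>V\<close>, and agree on \<open>A\<close>.
  The variable \<open>W\<close> is independent of \<open>(V, I)\<close>, but not of the index \<open>L\<close>, whose choice it governs.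
  Fixing the sample space to be a product of the ranges is no restriction: any realization
  can be transported to the joint law of \<open>(V, I, L, I', L', W)\<close>.
\<close>

definition nuts_follows_unif_hmc_on ::
    "real \<Rightarrow> nat \<Rightarrow> nat \<Rightarrow> 'a::euclidean_space \<Rightarrow> (('a \<times> int set) \<times> real) set \<Rightarrow> bool" where
  "nuts_follows_unif_hmc_on h kmax k x A \<longleftrightarrow>
     (\<exists>(M :: ('a \<times> int set \<times> int \<times> int set \<times> int \<times> real) measure) V I L I' L' W X X'.
        prob_space M \<and>
        V \<in> M \<rightarrow>\<^sub>M borel \<and> W \<in> M \<rightarrow>\<^sub>M borel \<and>
        I \<in> M \<rightarrow>\<^sub>M count_space UNIV \<and> L \<in> M \<rightarrow>\<^sub>M count_space UNIV \<and>
        I' \<in> M \<rightarrow>\<^sub>M count_space UNIV \<and> L' \<in> M \<rightarrow>\<^sub>M count_space UNIV \<and>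
        distr M draw_space (\<lambda>\<omega>. (V \<omega>, I \<omega>, L \<omega>)) = nuts_draws h kmax x \<and>
        distr M draw_space (\<lambda>\<omega>. (V \<omega>, I' \<omega>, L' \<omega>)) = unif_draws k \<and>
        distr M ((borel \<Otimes>\<^sub>M count_space UNIV) \<Otimes>\<^sub>M borel) (\<lambda>\<omega>. ((V \<omega>, I \<omega>), W \<omega>)) =
          nuts_selection_law h kmax x \<and>
        X = (\<lambda>\<omega>. endpoint h x (V \<omega>) (L \<omega>)) \<and> X' = (\<lambda>\<omega>. endpoint h x (V \<omega>) (L' \<omega>)) \<and>
        distr M borel X = nuts_kernel h kmax x \<and>
        distr M borel X' = unif_hmc_kernel h k x \<and>
        (\<forall>\<omega>\<in>space M. ((V \<omega>, I \<omega>), W \<omega>) \<in> A \<longrightarrow> X \<omega> = X' \<omega>))"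

end

theory Submission
  imports Defs
begin

text \<open>
  For the standard Gaussian target, one leapfrog step is a rotation of \<open>(x, v / s)\<close> by a fixed angle
  \<open>\<theta>\<close>, where \<open>\<theta> = 2 arcsin (h / 2)\<close> is close to \<open>h\<close> and \<open>s = sqrt (1 - h^2 / 4)\<close> is close to 1
  (\<open>leapfrog_iter_eq_elliptic_rotation\<close>). Everything about an index orbit can therefore be read off
  from angles.

  Let \<open>\<phi> = n \<theta>\<close> be the angle swept by an orbit of \<open>n + 1\<close> indices. Both inner products in the definition
  of a U-turn equal \<open>2 sin (\<phi> / 2)\<close> times a bracket, and this bracket is \<open>d cos (\<phi> / 2)\<close> up to a small
  error as soon as \<open>|x|^2\<close> and \<open>|v|^2\<close> are close to \<open>d\<close> and \<open>x \<bullet> v\<close> is close to 0, which is what the velocity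
  event says. So whether an orbit makes a U-turn depends on its length only, provided that \<open>\<phi>\<close> is not
  too close to \<open>pi\<close>; the margin \<open>\<delta>\<close> quantifies this (\<open>uturn_dichotomy\<close>). For \<open>k < kstar\<close> the time
  \<open>h (2^k - 1)\<close> is less than half of \<open>h (2^kstar - 1) < 2 pi\<close>, hence below \<open>pi + \<delta>\<close>, hence by the assumption
  on \<open>h\<close> at most \<open>pi - \<delta>\<close>. Thus orbits of length \<open>2^k\<close> with \<open>k < kstar\<close> never make a U-turn, while orbits of
  length \<open>2^kstar\<close> always do. The doubling then stops exactly at length \<open>2^(min kstar kmax)\<close>, and since
  each doubling goes left or right with equal probability, the selected orbit is uniformly distributed
  (\<open>orbit_law_eq_uniform\<close>).

  It remains to replace the index law on the orbit by the uniform law. The index law is the mixture of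
  the uniform law, with weight equal to the index level, and a residual law; the event that \<open>W\<close> is at most
  the level plays the role of the coin that selects the uniform part. This yields the coupling in
  \<open>nuts_follows_unif_hmc_onI\<close>. Since orbit selection is uniform on the larger of the two
  velocity events, the statement for the smaller one follows by monotonicity.

  The rejection probability has two parts. Bad velocities are controlled by Chernoff bounds for the
  standard Gaussian (\<open>std_gaussian_velocity_event\<close>). For good velocities, one minus the index level is at
  most the oscillation of the energy along the orbit, and conservation of \<open>s^2 |x|^2 + |v|^2\<close>
  shows that the energy error is \<open>h^2 / 8\<close> times the change of \<open>|x|^2\<close> (\<open>index_level_ge_near_shell\<close>).
\<close>

section \<open>Bounds for the sine\<close>

text \<open>
  On \<open>[0, pi/2]\<close> the sine is concave, so its graph lies above the chord.
\<close>

lemma jordan_sin_lower_bound: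
  fixes y :: real
  assumes "0 \<le> y" "y \<le> pi / 2"
  shows "2 * y / pi \<le> sin y"
proof -
  have "concave_on {0..pi/2} sin"
  proof (rule f''_le0_imp_concave)
    show "DERIV sin x :> cos x" for x :: real by (rule DERIV_sin)
    show "DERIV cos x :> - sin x" for x :: real by (rule DERIV_cos)
    show "- sin x \<le> 0" if "x \<in> {0..pi/2}" for x :: real
      using that by (auto intro!: sin_ge_zero)
  qed simp
  from concave_onD_Icc[OF this, of "2 * y / pi"] assms
  show ?thesis by (simp add: field_simps)
qed

text \<open>
  Used to bound the rotation angle \<open>2 * arcsin (h / 2)\<close> of a leapfrog step from above: a lower bound
  on the sine is an upper bound on the arc sine.
\<close>

lemma sin_cubic_lower_bound:
  fixes z :: real
  assumes "0 \<le> z"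
  shows "z - z ^ 3 / 6 \<le> sin z"
proof -
  let ?f = "\<lambda>z::real. sin z - z + z ^ 3 / 6"
  have "?f 0 \<le> ?f z"
  proof (rule DERIV_nonneg_imp_nondecreasing[OF assms])
    fix t :: real
    have "(sin (t / 2))\<^sup>2 \<le> (t / 2)\<^sup>2"
      using abs_sin_x_le_abs_x[of "t / 2"] by (simp only: abs_le_square_iff)
    then have "0 \<le> cos t - 1 + t\<^sup>2 / 2"
      using cos_double_sin[of "t / 2"] by (simp add: power2_eq_square)
    moreover have "(?f has_real_derivative (cos t - 1 + t\<^sup>2 / 2)) (at t)"
      by (auto intro!: derivative_eq_intros)
    ultimately show "\<exists>y. (?f has_real_derivative y) (at t) \<and> 0 \<le> y"
      by blast
  qed
  then show ?thesis by simp
qed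

section \<open>Leapfrog as an elliptic rotation\<close>

text \<open>
  For the standard Gaussian target a leapfrog step is the linear map with matrix
  \<open>(1 - h^2/2, h; - h (1 - h^2/4), 1 - h^2/2)\<close>. Its determinant is 1 and its trace is \<open>2 cos \<theta>\<close> with
  \<open>\<theta> = 2 arcsin (h / 2)\<close>; rescaling the velocity by \<open>1 / s\<close>, where \<open>s = sqrt (1 - h^2/4)\<close>, turns it
  into the rotation by \<open>\<theta>\<close>.
\<close>

definition leapfrog_angle :: "real \<Rightarrow> real" where
  "leapfrog_angle h = 2 * arcsin (h / 2)"

definition leapfrog_stretch :: "real \<Rightarrow> real" where
  "leapfrog_stretch h = sqrt (1 - h\<^sup>2 / 4)"

definition elliptic_rotation :: "real \<Rightarrow> real \<Rightarrow> 'a::euclidean_space \<times> 'a \<Rightarrow> 'a \<times> 'a" where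
  "elliptic_rotation s t =
     (\<lambda>(x, v). (cos t *\<^sub>R x + (sin t / s) *\<^sub>R v, cos t *\<^sub>R v - (s * sin t) *\<^sub>R x))"

lemma elliptic_rotation_0 [simp]: "elliptic_rotation s 0 = id"
  by (auto simp: elliptic_rotation_def)

lemma elliptic_rotation_add:
  assumes "s \<noteq> 0"
  shows "elliptic_rotation s (t + u) = elliptic_rotation s t \<circ> elliptic_rotation s u"
  using assms
  by (auto simp: elliptic_rotation_def fun_eq_iff sin_add cos_add algebra_simps add_divide_distrib)

lemma elliptic_rotation_mult_nat:
  assumes "s \<noteq> 0"
  shows "elliptic_rotation s t ^^ n = elliptic_rotation s (real n * t)"
  by (induction n) (simp_all add: distrib_right elliptic_rotation_add[OF assms])

lemma inv_elliptic_rotation: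
  assumes "s \<noteq> 0"
  shows "inv (elliptic_rotation s t) = elliptic_rotation s (- t)"
proof (rule inv_equality)
  fix z
  have "elliptic_rotation s (- t) \<circ> elliptic_rotation s t = id"
    using elliptic_rotation_add[OF assms, of "- t" t, symmetric] by simp
  then show "elliptic_rotation s (- t) (elliptic_rotation s t z) = z"
    by (metis comp_apply id_apply)
  have "elliptic_rotation s t \<circ> elliptic_rotation s (- t) = id"
    using elliptic_rotation_add[OF assms, of t "- t", symmetric] by simp
  then show "elliptic_rotation s t (elliptic_rotation s (- t) z) = z"
    by (metis comp_apply id_apply)
qed

text \<open>
  With \<open>q = h^2 / 4 \<le> 1 / 4\<close> the last bound is \<open>(1 + q)^2 (1 - q) = 1 + q - q^2 - q^3 \<ge> 1\<close>.
\<close>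

lemma leapfrog_stretch_bounds:
  assumes "0 < h" "h \<le> 1"
  shows "0 < leapfrog_stretch h" "leapfrog_stretch h \<le> 1"
    "(leapfrog_stretch h)\<^sup>2 = 1 - h\<^sup>2 / 4"
    "1 \<le> inverse (leapfrog_stretch h)"
    "inverse (leapfrog_stretch h) \<le> 1 + h\<^sup>2 / 4"
proof -
  define q where "q = h\<^sup>2 / 4"
  let ?s = "leapfrog_stretch h"
  have q: "0 \<le> q" "q \<le> 1 / 4"
    using assms by (auto simp: power_le_one q_def)
  show s: "0 < ?s" "?s \<le> 1" and s2: "?s\<^sup>2 = 1 - h\<^sup>2 / 4"
    using q by (auto simp: leapfrog_stretch_def q_def)
  then show "1 \<le> inverse ?s" by (simp add: one_le_inverse_iff)
  have "q * (1 - q - q * q) \<ge> 0"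
    using q mult_mono[of q "1/4" q "1/4"] by (intro mult_nonneg_nonneg) auto
  then have "1\<^sup>2 \<le> ((1 + q) * ?s)\<^sup>2"
    unfolding power_mult_distrib s2 q_def[symmetric] by (simp add: power2_eq_square algebra_simps)
  then have "1 \<le> (1 + q) * ?s"
    by (rule power2_le_imp_le) (use q s in auto)
  then show "inverse ?s \<le> 1 + h\<^sup>2 / 4"
    unfolding q_def[symmetric] using s by (simp add: field_simps)
qed

lemma leapfrog_eq_elliptic_rotation:
  assumes "0 < h" "h \<le> 1"
  shows "leapfrog h = elliptic_rotation (leapfrog_stretch h) (leapfrog_angle h)"
proof -
  let ?s = "leapfrog_stretch h" and ?t = "leapfrog_angle h"
  have s: "?s > 0" "?s * ?s = 1 - h\<^sup>2 / 4"
    using leapfrog_stretch_bounds[OF assms] by (simp_all add: power2_eq_square)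
  have sin2: "sin (arcsin (h / 2)) = h / 2"
    using assms by simp
  have cos2: "cos (arcsin (h / 2)) = ?s"
    using assms by (simp add: cos_arcsin leapfrog_stretch_def power_divide)
  have cos: "cos ?t = 1 - h\<^sup>2 / 2"
    unfolding leapfrog_angle_def cos_double_sin sin2 by (simp add: power_divide)
  have sin: "sin ?t = h * ?s"
    unfolding leapfrog_angle_def sin_double sin2 cos2 by simp
  have "?s * (h * ?s) = h * (1 - h\<^sup>2 / 4)"
    unfolding s(2)[symmetric] by (simp only: mult_ac)
  then have ssin: "?s * sin ?t = h * (1 - h\<^sup>2 / 4)" and sins: "sin ?t / ?s = h"
    using s by (simp_all add: sin)
  show ?thesis
    unfolding leapfrog_def elliptic_rotation_def cos ssin sins
    by (auto simp: fun_eq_iff Let_def inner_simps power2_eq_square algebra_simps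
        intro!: euclidean_eqI[where 'a='a])
qed

lemma leapfrog_iter_eq_elliptic_rotation:
  assumes "0 < h" "h \<le> 1"
  shows "leapfrog_iter h i =
    elliptic_rotation (leapfrog_stretch h) (real_of_int i * leapfrog_angle h)"
proof -
  have s: "leapfrog_stretch h \<noteq> 0"
    using leapfrog_stretch_bounds[OF assms] by simp
  show ?thesis
    by (simp add: leapfrog_iter_def leapfrog_eq_elliptic_rotation[OF assms]
        inv_elliptic_rotation[OF s] elliptic_rotation_mult_nat[OF s])
qed

text \<open>
  The simulated angle \<open>n \<theta>\<close> of an orbit exceeds the nominal time \<open>n h\<close> only by a relative error of
  order \<open>h^2\<close>. With \<open>y = h / 2\<close> the upper bound says that \<open>z = y + y^3 / 4\<close> satisfies \<open>sin z \<ge> y\<close>;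
  since \<open>z \<le> 9/8 y\<close>, the loss \<open>z^3 / 6\<close> in the cubic bound is at most \<open>y^3 / 4\<close>.
\<close>

lemma leapfrog_angle_bounds:
  assumes "0 < h" "h \<le> 1"
  shows "h \<le> leapfrog_angle h" "leapfrog_angle h \<le> h * (1 + h\<^sup>2 / 16)"
proof -
  have a: "0 \<le> arcsin (h / 2)" "sin (arcsin (h / 2)) = h / 2"
    using assms arcsin_le_arcsin[of 0 "h/2"] by auto
  then show "h \<le> leapfrog_angle h"
    using sin_x_le_x[of "arcsin (h / 2)"] by (simp add: leapfrog_angle_def)
  define y where "y = h / 2"
  define z where "z = y * (1 + y\<^sup>2 / 4)"
  have y: "0 < y" "y \<le> 1 / 2" using assms by (auto simp: y_def)
  have y2: "y\<^sup>2 \<le> 1 / 4"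
    using y power_mono[of y "1/2" 2] by (simp add: power_divide)
  have "z \<le> y * (9 / 8)"
    unfolding z_def using y y2 by (intro mult_left_mono) auto
  then have z_le: "z \<le> 9 / 8 * y" by simp
  have z0: "0 \<le> z" unfolding z_def using y by simp
  have "z ^ 3 \<le> (9 / 8 * y) ^ 3"
    by (rule power_mono) (use z_le z0 in auto)
  also have "\<dots> = (9 / 8) ^ 3 * y ^ 3" by (rule power_mult_distrib)
  also have "\<dots> \<le> 3 / 2 * y ^ 3"
    using y by (intro mult_right_mono) (auto simp: power3_eq_cube)
  finally have "z ^ 3 / 6 \<le> y ^ 3 / 4" by simp
  moreover have "z = y + y ^ 3 / 4"
    by (simp add: z_def algebra_simps power2_eq_square power3_eq_cube)
  ultimately have "y \<le> sin z"
    using sin_cubic_lower_bound[OF z0] by simp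
  then have "arcsin y \<le> arcsin (sin z)"
    by (intro arcsin_le_arcsin) (use y in auto)
  also have "\<dots> = z"
    by (rule arcsin_sin) (use z0 z_le y pi_ge_two in auto)
  finally show "leapfrog_angle h \<le> h * (1 + h\<^sup>2 / 16)"
    unfolding leapfrog_angle_def z_def y_def by (simp add: power_divide)
qed

section \<open>U-turns\<close>

text \<open>
  The sum-to-product formulas extract \<open>sin ((b - a) / 2)\<close> from both components of the displacement,
  \<open>cos b - cos a\<close> and \<open>sin b - sin a\<close>. For \<open>c = a\<close> and \<open>c = b\<close> the left-hand side is the product whose
  sign decides about a U-turn.
\<close>

lemma uturn_product_eq:
  fixes x v :: "'a::euclidean_space"
  assumes "s \<noteq> 0" and "z = (x, v)"
  shows "snd (elliptic_rotation s c z) \<bullet> (fst (elliptic_rotation s b z) - fst (elliptic_rotation s a z)) =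
    2 * sin ((b - a) / 2) *
      (sin c * sin ((a + b) / 2) * (s * (norm x)\<^sup>2) + cos c * cos ((a + b) / 2) * ((norm v)\<^sup>2 / s)
        - sin (c + (a + b) / 2) * (x \<bullet> v))"
proof -
  define m where "m = (a + b) / 2"
  define p where "p = (b - a) / 2"
  have cd: "cos b - cos a = - 2 * sin m * sin p"
  proof -
    have "(a - b) / 2 = - p" by (simp add: p_def field_simps)
    then show ?thesis unfolding cos_diff_cos by (simp add: m_def add.commute)
  qed
  have sd: "sin b - sin a = 2 * cos m * sin p"
    unfolding sin_diff_sin m_def p_def by (simp add: add.commute)
  have "fst (elliptic_rotation s b z) - fst (elliptic_rotation s a z) =
      (cos b - cos a) *\<^sub>R x + ((sin b - sin a) / s) *\<^sub>R v"
    by (simp add: assms elliptic_rotation_def algebra_simps diff_divide_distrib)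
  then have "snd (elliptic_rotation s c z) \<bullet> (fst (elliptic_rotation s b z) - fst (elliptic_rotation s a z)) =
     (cos c *\<^sub>R v - (s * sin c) *\<^sub>R x) \<bullet> ((cos b - cos a) *\<^sub>R x + ((sin b - sin a) / s) *\<^sub>R v)"
    by (simp add: assms(2) elliptic_rotation_def)
  also have "\<dots> = (cos b - cos a) * cos c * (x \<bullet> v) + (sin b - sin a) / s * cos c * (norm v)\<^sup>2
      - s * sin c * (cos b - cos a) * (norm x)\<^sup>2 - sin c * (sin b - sin a) * (x \<bullet> v)"
    unfolding inner_add_right inner_diff_left inner_scaleR_left inner_scaleR_right
      power2_norm_eq_inner inner_commute[of v x]
    using \<open>s \<noteq> 0\<close> by (simp add: field_simps)
  also have "\<dots> = 2 * sin p *
      (sin c * sin m * (s * (norm x)\<^sup>2) + cos c * cos m * ((norm v)\<^sup>2 / s)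
        - sin (c + m) * (x \<bullet> v))"
    unfolding cd sd sin_add by (simp add: algebra_simps)
  finally show ?thesis by (simp add: m_def p_def)
qed

text \<open>
  If \<open>s X\<close> and \<open>Y / s\<close> were both equal to \<open>d\<close> and \<open>xv\<close> were zero, the bracket of the preceding lemma
  would be \<open>d cos (c - m)\<close> by the addition theorem. The deviation stays small uniformly in the angles
  because \<open>|sin c sin m| + |cos c cos m|\<close> is one of \<open>|cos (c - m)|\<close> and \<open>|cos (c + m)|\<close>.
\<close>

lemma uturn_product_perturbation:
  fixes d e q s X Y xv c m :: real
  assumes s: "0 < s" "s \<le> 1" "inverse s \<le> 1 + q" and q: "q \<le> 1 / 4"
    and X: "\<bar>X - d\<bar> \<le> e" and Y: "\<bar>Y - d\<bar> \<le> e" and xv: "\<bar>xv\<bar> \<le> e" and d: "0 \<le> d"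
  shows "\<bar>sin c * sin m * (s * X) + cos c * cos m * (Y / s) - sin (c + m) * xv - d * cos (c - m)\<bar>
    \<le> q * d + 9 / 4 * e"
proof -
  have e: "0 \<le> e" using xv by simp
  have is1: "1 \<le> inverse s" using s by (simp add: one_le_inverse_iff)
  have q0: "0 \<le> q" using is1 s by simp
  \<comment> \<open>\<open>B\<close> bounds the deviation of both \<open>s X\<close> and \<open>Y / s\<close> from \<open>d\<close>: the term \<open>q d\<close> is the price of \<open>s \<noteq> 1\<close>, and
    \<open>5/4\<close> is an upper bound for \<open>1 / s\<close>.\<close>
  define B where "B = q * d + 5 / 4 * e"
  have B0: "0 \<le> B" using q0 d e by (simp add: B_def)
  have sinv: "1 - q \<le> s"
  proof -
    have "1 \<le> (1 + q) * s" using s by (simp add: field_simps)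
    moreover have "(1 - q) * (1 + q) \<le> 1" by (simp add: algebra_simps)
    ultimately have "(1 - q) * (1 + q) \<le> s * (1 + q)" by (simp add: mult.commute)
    then show ?thesis using q0 by (subst (asm) mult_le_cancel_right) auto
  qed
  have bX: "\<bar>s * X - d\<bar> \<le> B"
  proof -
    have "\<bar>s * X - d\<bar> = \<bar>s * (X - d) - (1 - s) * d\<bar>" by (simp add: algebra_simps)
    also have "\<dots> \<le> \<bar>s * (X - d)\<bar> + \<bar>(1 - s) * d\<bar>" by (rule abs_triangle_ineq4)
    also have "\<dots> = s * \<bar>X - d\<bar> + (1 - s) * d" using s d by (simp add: abs_mult)
    also have "\<dots> \<le> 1 * e + q * d"
      by (intro add_mono mult_mono) (use s X d e sinv in auto)
    finally show ?thesis using e by (simp add: B_def)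
  qed
  have bY: "\<bar>Y / s - d\<bar> \<le> B"
  proof -
    have "\<bar>Y / s - d\<bar> = \<bar>inverse s * (Y - d) + (inverse s - 1) * d\<bar>"
      by (simp add: algebra_simps divide_inverse)
    also have "\<dots> \<le> \<bar>inverse s * (Y - d)\<bar> + \<bar>(inverse s - 1) * d\<bar>" by (rule abs_triangle_ineq)
    also have "\<dots> = inverse s * \<bar>Y - d\<bar> + (inverse s - 1) * d" using s d is1 by (simp add: abs_mult)
    also have "\<dots> \<le> 5 / 4 * e + q * d"
      by (intro add_mono mult_mono) (use s Y d e q is1 in auto)
    finally show ?thesis by (simp add: B_def)
  qed
  have tri: "\<bar>sin c * sin m\<bar> + \<bar>cos c * cos m\<bar> \<le> 1"
  proof -
    have "\<bar>sin c * sin m\<bar> + \<bar>cos c * cos m\<bar> = \<bar>cos (c - m)\<bar> \<or>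
        \<bar>sin c * sin m\<bar> + \<bar>cos c * cos m\<bar> = \<bar>cos (c + m)\<bar>"
      unfolding cos_add cos_diff by linarith
    then show ?thesis using abs_cos_le_one by (metis)
  qed
  have abs3: "\<bar>A + B - C\<bar> \<le> \<bar>A\<bar> + \<bar>B\<bar> + \<bar>C\<bar>" for A B C :: real
    by linarith
  have "sin c * sin m * (s * X) + cos c * cos m * (Y / s) - sin (c + m) * xv - d * cos (c - m) =
     sin c * sin m * (s * X - d) + cos c * cos m * (Y / s - d) - sin (c + m) * xv"
    by (simp add: cos_diff algebra_simps)
  also have "\<bar>\<dots>\<bar> \<le> \<bar>sin c * sin m\<bar> * \<bar>s * X - d\<bar> + \<bar>cos c * cos m\<bar> * \<bar>Y / s - d\<bar> + \<bar>sin (c + m)\<bar> * \<bar>xv\<bar>"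
    unfolding abs_mult[symmetric] by (rule abs3)
  also have "\<dots> \<le> \<bar>sin c * sin m\<bar> * B + \<bar>cos c * cos m\<bar> * B + 1 * e"
    by (intro add_mono mult_mono bX bY xv) auto
  also have "\<dots> = (\<bar>sin c * sin m\<bar> + \<bar>cos c * cos m\<bar>) * B + e" by (simp add: algebra_simps)
  also have "\<dots> \<le> 1 * B + e" by (intro add_mono mult_right_mono tri B0) simp
  finally show ?thesis by (simp add: B_def)
qed

lemma uturn_interval_iff:
  fixes a :: int and k :: nat and z :: "'a::euclidean_space \<times> 'a"
  assumes h: "0 < h" "h \<le> 1"
  defines "R \<equiv> \<lambda>i. elliptic_rotation (leapfrog_stretch h) (real_of_int i * leapfrog_angle h) z"
  defines "b \<equiv> a + 2 ^ k - 1"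
  shows "uturn h z {a..<a + 2 ^ k} \<longleftrightarrow>
    snd (R b) \<bullet> (fst (R b) - fst (R a)) < 0 \<or> snd (R a) \<bullet> (fst (R b) - fst (R a)) < 0"
proof -
  have "{a..<a + 2 ^ k} = {a..b}" by (auto simp: b_def)
  moreover have "a \<le> b" by (simp add: b_def)
  ultimately have "Max {a..<a + 2 ^ k} = b" "Min {a..<a + 2 ^ k} = a"
    by (auto intro: Max_eqI Min_eqI)
  then show ?thesis
    by (simp add: uturn_def R_def leapfrog_iter_eq_elliptic_rotation[OF h] split: prod.split)
qed

text \<open>
  For either endpoint the angle to the midpoint of the orbit is \<open>\<phi> / 2\<close> up to sign, so both products
  in the definition of a U-turn have, up to a positive factor and the error \<open>err\<close>, the sign of
  \<open>sin (\<phi> / 2) * cos (\<phi> / 2)\<close>. Only the length of the orbit enters, not its position.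
\<close>

lemma uturn_sign_criterion:
  fixes x v :: "'a::euclidean_space" and a :: int and k :: nat
  assumes h: "0 < h" "h \<le> 1"
    and "\<bar>(norm x)\<^sup>2 - real DIM('a)\<bar> \<le> e" "\<bar>(norm v)\<^sup>2 - real DIM('a)\<bar> \<le> e" "\<bar>x \<bullet> v\<bar> \<le> e"
  defines "\<phi> \<equiv> (2 ^ k - 1) * leapfrog_angle h"
    and "err \<equiv> h\<^sup>2 / 4 * real DIM('a) + 9 / 4 * e"
  shows "0 \<le> sin (\<phi> / 2) \<Longrightarrow> err \<le> real DIM('a) * cos (\<phi> / 2) \<Longrightarrow>
      \<not> uturn h (x, v) {a..<a + 2 ^ k}"
    and "0 < sin (\<phi> / 2) \<Longrightarrow> err < - (real DIM('a) * cos (\<phi> / 2)) \<Longrightarrow>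
      uturn h (x, v) {a..<a + 2 ^ k}"
proof -
  define s where "s = leapfrog_stretch h"
  define A where "A = real_of_int a * leapfrog_angle h"
  define B where "B = real_of_int (a + 2 ^ k - 1) * leapfrog_angle h"
  define R where "R c = elliptic_rotation s c (x, v)" for c
  define br where "br c = sin c * sin ((A + B) / 2) * (s * (norm x)\<^sup>2)
    + cos c * cos ((A + B) / 2) * ((norm v)\<^sup>2 / s) - sin (c + (A + B) / 2) * (x \<bullet> v)" for c
  note s = leapfrog_stretch_bounds[OF h, folded s_def]
  have BA: "B - A = \<phi>"
    by (simp add: A_def B_def \<phi>_def algebra_simps)
  have prod: "snd (R c) \<bullet> (fst (R B) - fst (R A)) = 2 * sin (\<phi> / 2) * br c" for c
    unfolding R_def br_def using s by (subst uturn_product_eq[where x = x and v = v]) (auto simp: BA)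
  have br: "\<bar>br c - real DIM('a) * cos (c - (A + B) / 2)\<bar> \<le> err" for c
    unfolding br_def err_def
    by (rule uturn_product_perturbation) (use s assms(3-5) h in \<open>auto simp: power_le_one\<close>)
  have "A - (A + B) / 2 = - (\<phi> / 2)" "B - (A + B) / 2 = \<phi> / 2"
    unfolding BA[symmetric] by (simp_all add: field_simps)
  then have brA: "\<bar>br A - real DIM('a) * cos (\<phi> / 2)\<bar> \<le> err"
    and brB: "\<bar>br B - real DIM('a) * cos (\<phi> / 2)\<bar> \<le> err"
    using br[of A] br[of B] by (simp_all only: cos_minus)
  have iff: "uturn h (x, v) {a..<a + 2 ^ k} \<longleftrightarrow>
      2 * sin (\<phi> / 2) * br B < 0 \<or> 2 * sin (\<phi> / 2) * br A < 0"
    unfolding uturn_interval_iff[OF h] prod[symmetric] by (simp add: R_def A_def B_def s_def)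
  show "\<not> uturn h (x, v) {a..<a + 2 ^ k}"
    if "0 \<le> sin (\<phi> / 2)" "err \<le> real DIM('a) * cos (\<phi> / 2)"
    using that brA brB by (auto simp: iff not_less intro!: mult_nonneg_nonneg)
  show "uturn h (x, v) {a..<a + 2 ^ k}"
    if "0 < sin (\<phi> / 2)" "err < - (real DIM('a) * cos (\<phi> / 2))"
    using that brA by (auto simp: iff mult_less_0_iff)
qed

text \<open>
  The margin \<open>\<delta>\<close> is chosen to pay for two errors. Passing from the time \<open>t = h (2^k - 1)\<close> to the angle
  \<open>\<phi>\<close> costs at most a fraction of \<open>pi / 2 * h^2\<close>. What remains keeps \<open>\<phi>\<close> away from \<open>pi\<close>, so that by
  Jordan's inequality \<open>|cos (\<phi> / 2)| \<ge> |pi - \<phi>| / pi\<close> dominates the perturbation \<open>err / d\<close>.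
\<close>

lemma uturn_dichotomy:
  fixes x v :: "'a::euclidean_space" and a :: int and k :: nat
  assumes h: "0 < h" "h \<le> 1"
    and e: "\<bar>(norm x)\<^sup>2 - real DIM('a)\<bar> \<le> e" "\<bar>(norm v)\<^sup>2 - real DIM('a)\<bar> \<le> e" "\<bar>x \<bullet> v\<bar> \<le> e"
    and \<delta>: "\<delta> = pi / 2 * (5 * e / real DIM('a) + h\<^sup>2)"
  shows "h * (2 ^ k - 1) \<le> pi - \<delta> \<Longrightarrow> \<not> uturn h (x, v) {a..<a + 2 ^ k}"
    and "pi + \<delta> < h * (2 ^ k - 1) \<Longrightarrow> h * (2 ^ k - 1) < 2 * pi - \<delta> \<Longrightarrow>
      uturn h (x, v) {a..<a + 2 ^ k}"
proof -
  define d where "d = real DIM('a)"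
  define t where "t = h * (2 ^ k - 1)"
  define \<phi> where "\<phi> = (2 ^ k - 1) * leapfrog_angle h"
  have d: "0 < d" by (simp add: d_def)
  have n: "(0::real) \<le> 2 ^ k - 1" by simp
  have e0: "0 \<le> e" using e by simp
  have t0: "0 \<le> t" using h n by (simp add: t_def)
  have \<phi>: "t \<le> \<phi>" "\<phi> \<le> t * (1 + h\<^sup>2 / 16)"
    using mult_left_mono[OF leapfrog_angle_bounds(1)[OF h] n]
      mult_left_mono[OF leapfrog_angle_bounds(2)[OF h] n]
    by (simp_all add: t_def \<phi>_def mult_ac)
  have \<delta>d: "\<delta> * d / pi = 5 / 2 * e + h\<^sup>2 / 2 * d"
    using d by (simp add: \<delta> d_def field_simps)
  have \<delta>h: "pi / 2 * h\<^sup>2 \<le> \<delta>"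
    using e0 by (simp add: \<delta> field_simps)
  have ph: "0 < pi / 2 * h\<^sup>2" using h by simp
  then have \<delta>0: "0 < \<delta>" using \<delta>h by linarith
  have hd: "0 < h\<^sup>2 * d" using h d by simp
  {
    assume le: "t \<le> pi - \<delta>"
    have "t * (h\<^sup>2 / 16) \<le> pi * (h\<^sup>2 / 16)"
      using le \<delta>0 by (intro mult_right_mono) auto
    then have up: "\<phi> \<le> pi - \<delta> + pi * h\<^sup>2 / 16"
      using \<phi> le by (simp add: algebra_simps)
    then have \<phi>pi: "\<phi> \<le> pi" using \<delta>h ph by (simp add: algebra_simps)
    have \<phi>0: "0 \<le> \<phi>" using \<phi> t0 by simp
    have "2 * ((pi - \<phi>) / 2) / pi \<le> sin ((pi - \<phi>) / 2)"
      by (rule jordan_sin_lower_bound) (use \<phi>pi \<phi>0 in auto)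
    also have "\<dots> = cos (\<phi> / 2)"
      by (simp add: cos_sin_eq diff_divide_distrib)
    finally have c: "(pi - \<phi>) / pi \<le> cos (\<phi> / 2)"
      by (simp only: times_divide_eq_right nonzero_mult_div_cancel_left[OF zero_neq_numeral[symmetric]])
    have "h\<^sup>2 / 4 * d + 9 / 4 * e \<le> \<delta> * d / pi - h\<^sup>2 / 16 * d"
      unfolding \<delta>d using e0 hd by (simp add: algebra_simps)
    also have "\<dots> = d * ((\<delta> - pi * h\<^sup>2 / 16) / pi)"
      using d by (simp add: field_simps)
    also have "\<dots> \<le> d * ((pi - \<phi>) / pi)"
      using up d by (intro mult_left_mono divide_right_mono) auto
    also have "\<dots> \<le> d * cos (\<phi> / 2)"
      using c d by (intro mult_left_mono) auto
    finally show "\<not> uturn h (x, v) {a..<a + 2 ^ k}"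
      by (intro uturn_sign_criterion(1)[OF h e])
        (use \<phi>0 \<phi>pi in \<open>auto simp: d_def \<phi>_def intro!: sin_ge_zero\<close>)
  }
  {
    assume lo: "pi + \<delta> < t" and hi: "t < 2 * pi - \<delta>"
    have "t * (h\<^sup>2 / 16) \<le> (2 * pi) * (h\<^sup>2 / 16)"
      using hi \<delta>0 by (intro mult_right_mono) auto
    then have \<phi>2: "\<phi> < 2 * pi"
      using \<phi> hi \<delta>h by (simp add: algebra_simps)
    have \<phi>pi: "pi + \<delta> < \<phi>" using lo \<phi> by simp
    have "2 * ((\<phi> - pi) / 2) / pi \<le> sin ((\<phi> - pi) / 2)"
      by (rule jordan_sin_lower_bound) (use \<phi>pi \<phi>2 \<delta>0 in auto)
    also have "\<dots> = - cos (\<phi> / 2)"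
      by (simp add: cos_sin_eq diff_divide_distrib flip: sin_minus)
    finally have c: "(\<phi> - pi) / pi \<le> - cos (\<phi> / 2)"
      by (simp only: times_divide_eq_right nonzero_mult_div_cancel_left[OF zero_neq_numeral[symmetric]])
    have "h\<^sup>2 / 4 * d + 9 / 4 * e < \<delta> * d / pi"
      unfolding \<delta>d using e0 hd by (simp add: algebra_simps)
    also have "\<dots> = d * (\<delta> / pi)" by simp
    also have "\<dots> \<le> d * ((\<phi> - pi) / pi)"
      using \<phi>pi d by (intro mult_left_mono divide_right_mono) auto
    also have "\<dots> \<le> d * - cos (\<phi> / 2)"
      using c d by (intro mult_left_mono) auto
    finally show "uturn h (x, v) {a..<a + 2 ^ k}"
      by (intro uturn_sign_criterion(2)[OF h e])
        (use \<phi>pi \<phi>2 \<delta>0 pi_gt_zero in \<open>auto simp: d_def \<phi>_def intro!: sin_gt_zero\<close>)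
  }
qed

section \<open>Orbit selection\<close>

lemma suborbit_interval:
  fixes a :: int
  assumes "j \<le> k" "m < 2 ^ j"
  shows "suborbit {a..<a + 2 ^ k} j m =
    {a + int m * 2 ^ (k - j)..<a + int m * 2 ^ (k - j) + 2 ^ (k - j)}"
proof -
  define l where "l = k - j"
  have k: "k = j + l" using assms by (simp add: l_def)
  have Min: "Min {a..<a + 2 ^ k} = a"
    by (auto intro: Min_eqI)
  have card: "card {a..<a + 2 ^ k} = 2 ^ k" by (simp add: nat_power_eq)
  have lo: "real_of_int a + real m * real (2 ^ k) / 2 ^ j \<le> real_of_int i \<longleftrightarrow> a + int m * 2 ^ l \<le> i"
    for i :: int
  proof -
    have "real_of_int a + real m * real (2 ^ k) / 2 ^ j = real_of_int (a + int m * 2 ^ l)"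
      by (simp add: k power_add)
    then show ?thesis by (simp only: of_int_le_iff)
  qed
  have hi: "real_of_int i < real_of_int a + real (m + 1) * real (2 ^ k) / 2 ^ j \<longleftrightarrow>
      i < a + int m * 2 ^ l + 2 ^ l" for i :: int
  proof -
    have "real_of_int a + real (m + 1) * real (2 ^ k) / 2 ^ j = real_of_int (a + int m * 2 ^ l + 2 ^ l)"
      by (simp add: k power_add algebra_simps add_divide_distrib)
    then show ?thesis by (simp only: of_int_less_iff)
  qed
  have "int (m + 1) * 2 ^ l \<le> 2 ^ j * 2 ^ l"
  proof (intro mult_right_mono)
    have "m + 1 \<le> 2 ^ j" using assms(2) by simp
    then have "int (m + 1) \<le> int (2 ^ j)" by (simp only: of_nat_le_iff)
    then show "int (m + 1) \<le> 2 ^ j" by simp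
  qed simp
  then have "a + int m * 2 ^ l + 2 ^ l \<le> a + 2 ^ k"
    by (simp add: k power_add algebra_simps)
  moreover define p where "p = int m * 2 ^ l"
  moreover have "0 \<le> p" by (simp add: p_def)
  ultimately show ?thesis
    unfolding suborbit_def Min card lo hi l_def[symmetric] p_def[symmetric] by auto
qed

lemma not_sub_uturnI:
  fixes a :: int
  assumes "\<And>b i. i \<le> k \<Longrightarrow> \<not> uturn h z {b..<b + 2 ^ i}"
  shows "\<not> sub_uturn h z {a..<a + 2 ^ k}"
proof
  assume "sub_uturn h z {a..<a + 2 ^ k}"
  then obtain k' j m where *: "card {a..<a + 2 ^ k} = 2 ^ k'" "j \<le> k'" "m < 2 ^ j"
    "uturn h z (suborbit {a..<a + 2 ^ k} j m)"
    unfolding sub_uturn_def by blast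
  have "(2::nat) ^ k = 2 ^ k'" using *(1) by (simp add: nat_power_eq)
  then have "k' = k" by simp
  with * show False using assms by (simp add: suborbit_interval)
qed

text \<open>
  A uniform number below \<open>2 * N\<close> has a uniform lowest binary digit, independent of the remaining
  digits. In the orbit selection the digits are the successive choices between left and right.
\<close>

lemma map_pmf_of_set_parity:
  assumes "0 < N"
  shows "bind_pmf (pmf_of_set {..<2::nat}) (\<lambda>b. map_pmf (\<lambda>m. f (b + 2 * m)) (pmf_of_set {..<N})) =
    map_pmf f (pmf_of_set {..<2 * N})"
proof -
  have [simp]: "{..<2::nat} \<noteq> {}" "{..<N} \<noteq> {}"
    using assms by (auto simp: set_eq_iff intro: exI[of _ "0::nat"])
  have "bij_betw (\<lambda>(b, m). b + 2 * m) ({..<2} \<times> {..<N}) {..<2 * N}"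
    by (rule bij_betw_byWitness[where f' = "\<lambda>n. (n mod 2, n div 2)"]) auto
  then have "map_pmf (\<lambda>(b, m). b + 2 * m) (pmf_of_set ({..<2} \<times> {..<N})) = pmf_of_set {..<2 * N}"
    by (rule map_pmf_of_set_bij_betw) (use assms in auto)
  moreover have "pmf_of_set ({..<2::nat} \<times> {..<N}) = pair_pmf (pmf_of_set {..<2}) (pmf_of_set {..<N})"
    using assms by (intro pmf_eqI) (auto simp: pmf_pair indicator_def)
  ultimately have "pmf_of_set {..<2 * N} =
      map_pmf (\<lambda>(b, m). b + 2 * m) (pair_pmf (pmf_of_set {..<2}) (pmf_of_set {..<N}))"
    by simp
  then show ?thesis
    by (simp add: pair_pmf_def map_bind_pmf map_pmf_def bind_assoc_pmf bind_return_pmf)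
qed

text \<open>
  As long as no shorter orbit makes a U-turn, neither the sub-U-turn check nor the U-turn check stops
  the doubling before length \<open>2 ^ K\<close>; then the U-turn of every orbit of this length stops it, unless
  the doublings are used up earlier. The \<open>i\<close>-th doubling extends the orbit to the left by its
  own length or not at all, so the total shift to the left is a number with independent fair binary
  digits, in units of \<open>2 ^ j\<close>.
\<close>

lemma select_orbit_eq_uniform:
  assumes no: "\<And>b i. i < K \<Longrightarrow> \<not> uturn h z {b..<b + 2 ^ i}"
    and yes: "\<And>b. uturn h z {b..<b + 2 ^ K}"
    and "j < K"
  shows "select_orbit h z n {a..<a + 2 ^ j} =
    map_pmf (\<lambda>m. {a - int m * 2 ^ j..<a - int m * 2 ^ j + 2 ^ min K (j + n)})
      (pmf_of_set {..<2 ^ (min K (j + n) - j)})"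
  using \<open>j < K\<close>
proof (induction n arbitrary: j a)
  case 0
  then show ?case by (simp add: lessThan_Suc pmf_of_set_singleton)
next
  case (Suc n)
  define T where "T = min K (Suc j + n)"
  define G where "G m = {a - int m * 2 ^ j..<a - int m * 2 ^ j + 2 ^ T}" for m
  define S where "S b = (if b = 0 then {a + 2 ^ j..<a + 2 ^ j + 2 ^ j} else {a - 2 ^ j..<a - 2 ^ j + 2 ^ j})"
    for b :: nat
  have card: "int (card {a..<a + 2 ^ j}) = 2 ^ j" by simp
  have S01: "(\<lambda>i. i - 2 ^ j) ` {a..<a + 2 ^ j} = S 1" "(\<lambda>i. i + 2 ^ j) ` {a..<a + 2 ^ j} = S 0"
    using image_add_atLeastLessThan'[of "- (2 ^ j)" a "a + 2 ^ j"]
      image_add_atLeastLessThan'[of "2 ^ j" a "a + 2 ^ j"]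
    by (simp_all add: S_def)
  have "a - 2 ^ j \<in> S 1" "a - 2 ^ j \<notin> S 0" by (auto simp: S_def)
  then have "S 1 \<noteq> S 0" by blast
  then have "inj_on S {..<2}"
    by (auto simp: inj_on_def numeral_2_eq_2 less_Suc_eq)
  then have "map_pmf S (pmf_of_set {..<2}) = pmf_of_set (S ` {..<2})"
    by (intro map_pmf_of_set_inj) (auto simp: lessThan_empty_iff)
  also have "S ` {..<2} = {S 1, S 0}"
    by (auto simp: numeral_2_eq_2 lessThan_Suc)
  finally have draw: "pmf_of_set {S 1, S 0} = map_pmf S (pmf_of_set {..<2})" ..
  have "\<not> sub_uturn h z {b..<b + 2 ^ j}" for b
    by (intro not_sub_uturnI no) (use Suc.prems in simp)
  then have sub: "\<not> sub_uturn h z (S b)" for b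
    unfolding S_def by (cases "b = 0") (simp_all only: simp_thms if_True if_False)
  have union: "{a..<a + 2 ^ j} \<union> S b = {a - int b * 2 ^ j..<a - int b * 2 ^ j + 2 ^ Suc j}"
    if "b < 2" for b
    using that by (auto simp: S_def numeral_2_eq_2 less_Suc_eq)
  have cont: "(if uturn h z ({a..<a + 2 ^ j} \<union> S b) then return_pmf ({a..<a + 2 ^ j} \<union> S b)
      else select_orbit h z n ({a..<a + 2 ^ j} \<union> S b)) =
    map_pmf (\<lambda>m. G (b + 2 * m)) (pmf_of_set {..<2 ^ (T - Suc j)})" if "b < 2" for b
  proof (cases "Suc j = K")
    case True
    then show ?thesis
      using yes[of "a - int b * 2 ^ j"]
      by (simp add: union[OF that] T_def G_def lessThan_Suc pmf_of_set_singleton)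
  next
    case False
    then have "Suc j < K" using Suc.prems by simp
    then show ?thesis
      using no[of "Suc j" "a - int b * 2 ^ j"] Suc.IH[of "Suc j" "a - int b * 2 ^ j"]
      unfolding union[OF that] by (simp add: T_def G_def algebra_simps)
  qed
  have "select_orbit h z (Suc n) {a..<a + 2 ^ j} =
    bind_pmf (pmf_of_set {..<2}) (\<lambda>b. map_pmf (\<lambda>m. G (b + 2 * m)) (pmf_of_set {..<2 ^ (T - Suc j)}))"
    unfolding select_orbit.simps card S01 draw bind_map_pmf
    by (intro bind_pmf_cong refl) (auto simp: sub cont lessThan_empty_iff)
  also have "\<dots> = map_pmf G (pmf_of_set {..<2 * 2 ^ (T - Suc j)})"
    by (rule map_pmf_of_set_parity) simp
  also have "2 * 2 ^ (T - Suc j) = (2::nat) ^ (T - j)"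
    using Suc.prems by (simp add: T_def Suc_diff_Suc flip: power_Suc)
  finally show ?case by (simp add: G_def T_def)
qed

lemma orbit_law_eq_uniform:
  assumes "\<And>b i. i < K \<Longrightarrow> \<not> uturn h z {b..<b + 2 ^ i}"
    and "\<And>b. uturn h z {b..<b + 2 ^ K}"
    and "0 < K"
  shows "orbit_law h kmax z = pmf_of_set (index_orbits0 (min K kmax))"
proof -
  let ?T = "min K kmax"
  let ?f = "\<lambda>m. {- int m..<- int m + 2 ^ ?T}"
  have "{0..<1} = {0::int}" by auto
  then have "orbit_law h kmax z = map_pmf ?f (pmf_of_set {..<2 ^ ?T})"
    using select_orbit_eq_uniform[OF assms, of kmax 0] \<open>{0..<1} = {0::int}\<close>
    by (simp add: orbit_law_def)
  also have "bij_betw ?f {..<2 ^ ?T} (index_orbits0 ?T)"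
  proof (intro bij_betw_imageI inj_onI)
    fix m m' :: nat
    assume "?f m = ?f m'"
    then show "m = m'"
      using atLeastLessThan_eq_iff[of "- int m" "- int m + 2 ^ ?T" "- int m'" "- int m' + 2 ^ ?T"]
      by simp
  next
    show "?f ` {..<2 ^ ?T} = index_orbits0 ?T"
    proof (intro equalityI subsetI)
      fix I assume "I \<in> index_orbits0 ?T"
      then obtain a :: int where a: "I = {a..<a + 2 ^ ?T}" "a \<le> 0" "0 < a + 2 ^ ?T"
        by (auto simp: index_orbits0_def)
      then have "I = ?f (nat (- a))" by simp
      moreover have "nat (- a) < 2 ^ ?T" using a by (simp add: nat_less_iff)
      ultimately show "I \<in> ?f ` {..<2 ^ ?T}" by blast
    next
      fix I assume "I \<in> ?f ` {..<2 ^ ?T}"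
      then obtain m where I: "I = ?f m" and "m < 2 ^ ?T" by auto
      then have "int m < int (2 ^ ?T)" by (simp only: of_nat_less_iff)
      then have "0 \<in> I" by (simp add: I)
      then show "I \<in> index_orbits0 ?T"
        unfolding index_orbits0_def I by blast
    qed
  qed
  then have "map_pmf ?f (pmf_of_set {..<2 ^ ?T}) = pmf_of_set (index_orbits0 ?T)"
    by (rule map_pmf_of_set_bij_betw) (auto simp: lessThan_empty_iff)
  finally show ?thesis .
qed

section \<open>Energy error and index level\<close>

lemma norm_add_scaleR_sq:
  fixes x v :: "'a::real_inner"
  shows "(norm (a *\<^sub>R x + b *\<^sub>R v))\<^sup>2 = a\<^sup>2 * (norm x)\<^sup>2 + b\<^sup>2 * (norm v)\<^sup>2 + 2 * a * b * (x \<bullet> v)"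
  unfolding power2_norm_eq_inner
  by (simp add: inner_simps inner_commute[of v x] power2_eq_square algebra_simps)

text \<open>
  The rotation preserves \<open>s^2 |x|^2 + |v|^2\<close> with \<open>s^2 = 1 - h^2 / 4\<close>. This differs from twice the
  energy only by \<open>h^2 / 4 * |x|^2\<close>, which therefore carries the whole energy error.
\<close>

lemma energy_leapfrog_iter:
  fixes x v :: "'a::euclidean_space"
  assumes h: "0 < h" "h \<le> 1"
  shows "energy (leapfrog_iter h i (x, v)) - energy (x, v) =
    h\<^sup>2 / 8 * ((norm (endpoint h x v i))\<^sup>2 - (norm x)\<^sup>2)"
proof -
  define s where "s = leapfrog_stretch h"
  define t where "t = real_of_int i * leapfrog_angle h"
  note s = leapfrog_stretch_bounds[OF h, folded s_def]
  define x' where "x' = cos t *\<^sub>R x + (sin t / s) *\<^sub>R v"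
  define v' where "v' = cos t *\<^sub>R v - (s * sin t) *\<^sub>R x"
  have z: "leapfrog_iter h i (x, v) = (x', v')"
    by (simp add: leapfrog_iter_eq_elliptic_rotation[OF h] elliptic_rotation_def s_def t_def x'_def v'_def)
  have nx: "(norm x')\<^sup>2 = (cos t)\<^sup>2 * (norm x)\<^sup>2 + (sin t / s)\<^sup>2 * (norm v)\<^sup>2 + 2 * cos t * (sin t / s) * (x \<bullet> v)"
    unfolding x'_def by (rule norm_add_scaleR_sq)
  have nv: "(norm v')\<^sup>2 = (cos t)\<^sup>2 * (norm v)\<^sup>2 + (s * sin t)\<^sup>2 * (norm x)\<^sup>2 - 2 * cos t * (s * sin t) * (x \<bullet> v)"
    unfolding v'_def using norm_add_scaleR_sq[of "cos t" v "- (s * sin t)" x] by (simp add: inner_commute)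
  have "s\<^sup>2 * (norm x')\<^sup>2 + (norm v')\<^sup>2 =
      ((cos t)\<^sup>2 + (sin t)\<^sup>2) * (s\<^sup>2 * (norm x)\<^sup>2 + (norm v)\<^sup>2)"
  proof -
    define k where "k = sin t / s"
    have k: "sin t = s * k" using s(1) by (simp add: k_def)
    show ?thesis
      unfolding nx nv k_def[symmetric] unfolding k by (simp add: algebra_simps power2_eq_square)
  qed
  then have "s\<^sup>2 * (norm x')\<^sup>2 + (norm v')\<^sup>2 = s\<^sup>2 * (norm x)\<^sup>2 + (norm v)\<^sup>2" by simp
  then show ?thesis
    unfolding s(3) by (simp add: energy_def z endpoint_def field_simps)
qed

text \<open>
  The squared norm along the orbit is a convex combination of \<open>|x|^2\<close> and \<open>|v|^2 / s^2\<close>, both close to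
  \<open>d\<close>, plus a multiple of \<open>x \<bullet> v\<close> with a coefficient of modulus at most \<open>1 / s \<le> 5/4\<close>.
\<close>

lemma norm_endpoint_oscillation:
  fixes x v :: "'a::euclidean_space"
  assumes h: "0 < h" "h \<le> 1"
    and e: "\<bar>(norm x)\<^sup>2 - real DIM('a)\<bar> \<le> e" "\<bar>(norm v)\<^sup>2 - real DIM('a)\<bar> \<le> e" "\<bar>x \<bullet> v\<bar> \<le> e"
  shows "(norm (endpoint h x v i))\<^sup>2 - (norm (endpoint h x v j))\<^sup>2 \<le>
    2 * h\<^sup>2 * real DIM('a) + 8 * e"
proof -
  define d where "d = real DIM('a)"
  define s where "s = leapfrog_stretch h"
  define q where "q = h\<^sup>2 / 4"
  define R where "R = inverse s"
  note s = leapfrog_stretch_bounds[OF h, folded s_def]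
  have q: "0 \<le> q" "q \<le> 1 / 4" using h by (auto simp: q_def power_le_one)
  have R: "1 \<le> R" "R \<le> 1 + q" "R \<le> 5 / 4" using s q by (auto simp: R_def q_def)
  have "R\<^sup>2 \<le> (1 + q)\<^sup>2" using R by (intro power_mono) auto
  also have "\<dots> \<le> 1 + 9 / 4 * q"
    using mult_right_mono[OF q(2) q(1)] by (simp add: power2_eq_square algebra_simps)
  finally have R2: "R\<^sup>2 \<le> 1 + 9 / 4 * q" .
  have R2': "1 \<le> R\<^sup>2" using R by simp
  have e0: "0 \<le> e" and d0: "0 \<le> d" using e by (auto simp: d_def)
  have norm: "(norm (endpoint h x v i))\<^sup>2 =
      (cos t)\<^sup>2 * (norm x)\<^sup>2 + (sin t)\<^sup>2 * (R\<^sup>2 * (norm v)\<^sup>2) + R * (sin (2 * t) * (x \<bullet> v))"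
    if "t = real_of_int i * leapfrog_angle h" for i t
    unfolding sin_double using norm_add_scaleR_sq[of "cos t" x "sin t / s" v]
    by (simp add: endpoint_def leapfrog_iter_eq_elliptic_rotation[OF h] elliptic_rotation_def
        that[symmetric] s_def[symmetric] R_def power_mult_distrib divide_inverse mult_ac)
  have xv: "\<bar>R * (sin (2 * t) * (x \<bullet> v))\<bar> \<le> 5 / 4 * e" for t
  proof -
    have "\<bar>R\<bar> * (\<bar>sin (2 * t)\<bar> * \<bar>x \<bullet> v\<bar>) \<le> 5 / 4 * (1 * e)"
      using R e by (intro mult_mono) auto
    then show ?thesis by (simp add: abs_mult)
  qed
  have X: "d - e \<le> (norm x)\<^sup>2" "(norm x)\<^sup>2 \<le> R\<^sup>2 * (d + e)"
    using e(1) mult_right_mono[OF R2', of "d + e"] e0 d0 by (auto simp: d_def)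
  have V: "d - e \<le> R\<^sup>2 * (norm v)\<^sup>2" "R\<^sup>2 * (norm v)\<^sup>2 \<le> R\<^sup>2 * (d + e)"
    using e(2) mult_right_mono[OF R2', of "(norm v)\<^sup>2"] by (auto simp: d_def intro: mult_left_mono)
  have up: "(norm (endpoint h x v i))\<^sup>2 \<le> R\<^sup>2 * (d + e) + 5 / 4 * e" for i
  proof -
    define t where "t = real_of_int i * leapfrog_angle h"
    have "(norm (endpoint h x v i))\<^sup>2 \<le>
        (cos t)\<^sup>2 * (R\<^sup>2 * (d + e)) + (sin t)\<^sup>2 * (R\<^sup>2 * (d + e)) + 5 / 4 * e"
      unfolding norm[OF t_def] using xv[of t] by (intro add_mono mult_left_mono X V) auto
    also have "\<dots> = R\<^sup>2 * (d + e) + 5 / 4 * e"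
      unfolding distrib_right[symmetric] by simp
    finally show ?thesis .
  qed
  have lo: "d - e - 5 / 4 * e \<le> (norm (endpoint h x v i))\<^sup>2" for i
  proof -
    define t where "t = real_of_int i * leapfrog_angle h"
    have "d - e - 5 / 4 * e = (cos t)\<^sup>2 * (d - e) + (sin t)\<^sup>2 * (d - e) + (- (5 / 4 * e))"
      unfolding distrib_right[symmetric] by simp
    also have "\<dots> \<le> (norm (endpoint h x v i))\<^sup>2"
      unfolding norm[OF t_def] using xv[of t] by (intro add_mono mult_left_mono X V) auto
    finally show ?thesis .
  qed
  have "R\<^sup>2 * (d + e) \<le> (1 + 9 / 4 * q) * (d + e)"
    using R2 d0 e0 by (intro mult_right_mono) auto
  moreover have "q * e \<le> 1 / 4 * e" using q e0 by (intro mult_right_mono)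
  moreover have "(1 + 9 / 4 * q) * (d + e) = d + e + 9 / 16 * (h\<^sup>2 * d) + 9 / 4 * (q * e)"
    by (simp add: q_def algebra_simps)
  ultimately have "R\<^sup>2 * (d + e) \<le> d + 25 / 16 * e + 9 / 16 * (h\<^sup>2 * d)" by linarith
  moreover have "0 \<le> h\<^sup>2 * d" using d0 by simp
  ultimately show ?thesis
    using up[of i] lo[of j] e0 unfolding d_def[symmetric] mult.assoc by linarith
qed

lemma index_weight_pos: "0 < index_weight h z i"
  by (simp add: index_weight_def)

lemma index_level_le_1:
  assumes "finite I" "I \<noteq> {}"
  shows "index_level h x v I \<le> 1"
proof -
  let ?w = "index_weight h (x, v)"
  have "real (card I) * Min (?w ` I) \<le> sum ?w I"
    using assms by (intro sum_bounded_below[of I "Min (?w ` I)" ?w, simplified]) auto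
  moreover have "0 < sum ?w I"
    using assms by (intro sum_pos) (auto simp: index_weight_pos)
  ultimately show ?thesis
    unfolding index_level_def by (simp add: field_simps)
qed

lemma index_level_nonneg:
  assumes "finite I" "I \<noteq> {}"
  shows "0 \<le> index_level h x v I"
  unfolding index_level_def using assms
  by (intro mult_nonneg_nonneg) (auto intro!: sum_nonneg less_imp_le[OF index_weight_pos] Min.boundedI)

text \<open>
  All index weights lie within a factor \<open>exp c\<close> of the smallest one, hence the level is at least
  \<open>exp (- c)\<close>.
\<close>

lemma index_level_lower_bound:
  assumes I: "finite I" "I \<noteq> {}"
    and osc: "\<And>i j. i \<in> I \<Longrightarrow> j \<in> I \<Longrightarrow>
      energy (leapfrog_iter h i (x, v)) - energy (leapfrog_iter h j (x, v)) \<le> c"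
  shows "1 - c \<le> index_level h x v I"
proof -
  let ?w = "index_weight h (x, v)"
  have "Min (?w ` I) \<in> ?w ` I" using I by (intro Min_in) auto
  then obtain i where i: "i \<in> I" "Min (?w ` I) = ?w i" by auto
  have "?w j \<le> exp c * ?w i" if "j \<in> I" for j
    using osc[OF i(1) that] by (simp add: index_weight_def flip: exp_add)
  then have "sum ?w I \<le> real (card I) * (exp c * ?w i)"
    by (intro sum_bounded_above[of I ?w, simplified])
  moreover have pos: "0 < sum ?w I"
    using I by (intro sum_pos) (auto simp: index_weight_pos)
  ultimately have "exp (- c) * sum ?w I \<le> real (card I) * ?w i"
    by (simp add: exp_minus field_simps)
  then have "exp (- c) \<le> index_level h x v I"
    unfolding index_level_def i(2) using pos by (simp add: field_simps)
  then show ?thesis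
    using exp_ge_add_one_self[of "- c"] by linarith
qed

lemma index_level_ge_near_shell:
  fixes x v :: "'a::euclidean_space"
  assumes h: "0 < h" "h \<le> 1"
    and e: "\<bar>(norm x)\<^sup>2 - real DIM('a)\<bar> \<le> e" "\<bar>(norm v)\<^sup>2 - real DIM('a)\<bar> \<le> e" "\<bar>x \<bullet> v\<bar> \<le> e"
    and I: "finite I" "I \<noteq> {}"
  shows "1 - (h\<^sup>2 * e + h ^ 4 * real DIM('a) / 4) \<le> index_level h x v I"
proof (rule index_level_lower_bound[OF I])
  fix i j
  have "energy (leapfrog_iter h i (x, v)) - energy (leapfrog_iter h j (x, v)) =
      h\<^sup>2 / 8 * ((norm (endpoint h x v i))\<^sup>2 - (norm (endpoint h x v j))\<^sup>2)"
    using energy_leapfrog_iter[OF h, of i x v] energy_leapfrog_iter[OF h, of j x v]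
    by (simp add: algebra_simps)
  also have "\<dots> \<le> h\<^sup>2 / 8 * (2 * h\<^sup>2 * real DIM('a) + 8 * e)"
    by (intro mult_left_mono norm_endpoint_oscillation[OF h e]) simp
  also have "\<dots> = h\<^sup>2 * e + h ^ 4 * real DIM('a) / 4"
    by (simp add: algebra_simps power4_eq_xxxx power2_eq_square)
  finally show "energy (leapfrog_iter h i (x, v)) - energy (leapfrog_iter h j (x, v)) \<le>
      h\<^sup>2 * e + h ^ 4 * real DIM('a) / 4" .
qed

section \<open>Mixtures of discrete laws\<close>

definition dependent_pair_pmf :: "'a pmf \<Rightarrow> ('a \<Rightarrow> 'b pmf) \<Rightarrow> ('a \<times> 'b) pmf" where
  "dependent_pair_pmf P Q = bind_pmf P (\<lambda>a. map_pmf (Pair a) (Q a))"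

lemma map_fst_dependent_pair_pmf: "map_pmf fst (dependent_pair_pmf P Q) = P"
  by (simp add: dependent_pair_pmf_def map_bind_pmf pmf.map_comp o_def map_pmf_const bind_return_pmf')

lemma map_dependent_pair_pmf:
  "map_pmf (\<lambda>(a, b). (a, f a b)) (dependent_pair_pmf P Q) =
    dependent_pair_pmf P (\<lambda>a. map_pmf (f a) (Q a))"
  by (simp add: dependent_pair_pmf_def map_bind_pmf pmf.map_comp o_def)

lemma emeasure_dependent_pair_pmf:
  "emeasure (dependent_pair_pmf P Q) S = (\<integral>\<^sup>+a. emeasure (Q a) {b. (a, b) \<in> S} \<partial>P)"
  by (simp add: dependent_pair_pmf_def vimage_def)

text \<open>
  Measurable dependence of a discrete law on a parameter. The countable set that carries all the laws
  is essential when the outcomes form an uncountable type, such as sets of integers: it reduces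
  integrals over the outcome to countable sums of measurable functions of the parameter, so that no
  measurability in the outcome is ever needed.
\<close>

definition countable_kernel :: "'n measure \<Rightarrow> ('n \<Rightarrow> 'c pmf) \<Rightarrow> bool" where
  "countable_kernel N C \<longleftrightarrow>
     countable (\<Union>v\<in>space N. set_pmf (C v)) \<and> (\<forall>c. (\<lambda>v. pmf (C v) c) \<in> borel_measurable N)"

lemma countable_kernel_const: "countable_kernel N (\<lambda>_. p)"
  unfolding countable_kernel_def
  by (auto intro: countable_subset[OF _ countable_set_pmf[of p]])

lemma countable_kernel_if:
  assumes P: "countable_kernel N P" and Q: "countable_kernel N Q" and [measurable]: "Measurable.pred N b"
  shows "countable_kernel N (\<lambda>v. if b v then P v else Q v)"
  unfolding countable_kernel_def
proof (intro conjI allI)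
  show "countable (\<Union>v\<in>space N. set_pmf (if b v then P v else Q v))"
    by (rule countable_subset[of _ "(\<Union>v\<in>space N. set_pmf (P v)) \<union> (\<Union>v\<in>space N. set_pmf (Q v))"])
      (use P Q in \<open>auto simp: countable_kernel_def split: if_splits\<close>)
  fix c
  have [measurable]: "(\<lambda>v. pmf (P v) c) \<in> borel_measurable N" "(\<lambda>v. pmf (Q v) c) \<in> borel_measurable N"
    using P Q by (auto simp: countable_kernel_def)
  have "(\<lambda>v. if b v then pmf (P v) c else pmf (Q v) c) \<in> borel_measurable N" by measurable
  then show "(\<lambda>v. pmf (if b v then P v else Q v) c) \<in> borel_measurable N"
    by (simp add: if_distrib[of "\<lambda>p. pmf p c"])
qed

lemma borel_measurable_nn_integral_countable_kernel:
  fixes f :: "'n \<Rightarrow> 'c \<Rightarrow> ennreal"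
  assumes C: "countable_kernel N C"
    and f: "\<And>u c. u \<in> space N \<Longrightarrow> c \<in> set_pmf (C u) \<Longrightarrow> (\<lambda>v. f v c) \<in> borel_measurable N"
  shows "(\<lambda>v. \<integral>\<^sup>+c. f v c \<partial>measure_pmf (C v)) \<in> borel_measurable N"
proof -
  define K where "K = (\<Union>v\<in>space N. set_pmf (C v))"
  have K: "countable K" using C by (simp add: countable_kernel_def K_def)
  interpret sigma_finite_measure "count_space K"
    by (rule sigma_finite_measure_count_space_countable[OF K])
  have pm: "(\<lambda>v. pmf (C v) c) \<in> borel_measurable N" for c
    using C by (simp add: countable_kernel_def)
  have "case_prod (\<lambda>v c. ennreal (pmf (C v) c) * f v c) \<in> borel_measurable (N \<Otimes>\<^sub>M count_space K)"
    unfolding case_prod_beta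
    by (rule measurable_compose_countable'[where g = snd and I = K and
          f = "\<lambda>c z. ennreal (pmf (C (fst z)) c) * f (fst z) c"])
      (use K in \<open>auto intro!: borel_measurable_times_ennreal measurable_compose[OF measurable_fst]
         measurable_compose[OF _ measurable_ennreal] pm f simp: K_def\<close>)
  then have "(\<lambda>v. \<integral>\<^sup>+c. ennreal (pmf (C v) c) * f v c \<partial>count_space K) \<in> borel_measurable N"
    by (rule borel_measurable_nn_integral)
  moreover have "(\<integral>\<^sup>+c. f v c \<partial>measure_pmf (C v)) = (\<integral>\<^sup>+c. ennreal (pmf (C v) c) * f v c \<partial>count_space K)"
    if "v \<in> space N" for v
    unfolding nn_integral_measure_pmf
    by (rule nn_integral_count_space_eq) (use that in \<open>auto simp: K_def set_pmf_iff\<close>)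
  ultimately show ?thesis
    by (simp cong: measurable_cong)
qed

lemma countable_kernel_bind:
  assumes P: "countable_kernel N P"
    and Q: "\<And>u a. u \<in> space N \<Longrightarrow> a \<in> set_pmf (P u) \<Longrightarrow> countable_kernel N (\<lambda>v. Q v a)"
  shows "countable_kernel N (\<lambda>v. bind_pmf (P v) (Q v))"
  unfolding countable_kernel_def
proof (intro conjI allI)
  let ?A = "\<Union>v\<in>space N. set_pmf (P v)"
  have "countable ?A" using P by (simp add: countable_kernel_def)
  moreover have "countable (\<Union>v\<in>space N. set_pmf (Q v a))" if "a \<in> ?A" for a
    using Q that by (auto simp: countable_kernel_def)
  ultimately have "countable (\<Union>a\<in>?A. \<Union>v\<in>space N. set_pmf (Q v a))"
    by (rule countable_UN)
  then show "countable (\<Union>v\<in>space N. set_pmf (bind_pmf (P v) (Q v)))"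
    by (rule countable_subset[rotated]) auto
  fix c
  have "(\<lambda>v. \<integral>\<^sup>+a. ennreal (pmf (Q v a) c) \<partial>measure_pmf (P v)) \<in> borel_measurable N"
    by (intro borel_measurable_nn_integral_countable_kernel[OF P] measurable_compose[OF _ measurable_ennreal])
      (use Q in \<open>auto simp: countable_kernel_def\<close>)
  then have "(\<lambda>v. enn2real (\<integral>\<^sup>+a. ennreal (pmf (Q v a) c) \<partial>measure_pmf (P v))) \<in> borel_measurable N"
    by measurable
  then show "(\<lambda>v. pmf (bind_pmf (P v) (Q v)) c) \<in> borel_measurable N"
    unfolding ennreal_pmf_bind[symmetric] by simp
qed

lemma countable_kernel_dependent_pair:
  assumes "countable_kernel N P"
    and "\<And>u a. u \<in> space N \<Longrightarrow> a \<in> set_pmf (P u) \<Longrightarrow> countable_kernel N (\<lambda>v. Q v a)"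
  shows "countable_kernel N (\<lambda>v. dependent_pair_pmf (P v) (Q v))"
  unfolding dependent_pair_pmf_def map_pmf_def
  by (intro countable_kernel_bind countable_kernel_const assms)

lemma countable_kernel_compose:
  assumes "countable_kernel N C" and f: "f \<in> M \<rightarrow>\<^sub>M N"
  shows "countable_kernel M (\<lambda>v. C (f v))"
  unfolding countable_kernel_def
proof (intro conjI allI)
  show "countable (\<Union>v\<in>space M. set_pmf (C (f v)))"
    by (rule countable_subset[of _ "\<Union>v\<in>space N. set_pmf (C v)"])
      (use assms measurable_space[OF f] in \<open>auto simp: countable_kernel_def\<close>)
  show "(\<lambda>v. pmf (C (f v)) c) \<in> borel_measurable M" for c
    using assms by (intro measurable_compose[OF f]) (auto simp: countable_kernel_def)
qed

lemma countable_kernel_sets_cong: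
  assumes "countable_kernel N C" "sets N = sets N'"
  shows "countable_kernel N' C"
  using assms(1) measurable_cong_sets[OF assms(2) refl[of "sets (borel :: real measure)"]]
    sets_eq_imp_space_eq[OF assms(2)]
  by (simp add: countable_kernel_def)

lemma borel_measurable_emeasure_countable_kernel:
  assumes C: "countable_kernel N C" and T: "\<And>c. (\<lambda>v. T v c) \<in> N \<rightarrow>\<^sub>M Q" and S: "S \<in> sets Q"
  shows "(\<lambda>v. emeasure (measure_pmf (C v)) {c. T v c \<in> S}) \<in> borel_measurable N"
proof -
  have "(\<lambda>v. \<integral>\<^sup>+c. indicator S (T v c) \<partial>measure_pmf (C v)) \<in> borel_measurable N"
    by (intro borel_measurable_nn_integral_countable_kernel C measurable_compose[OF T]) (use S in simp)
  moreover have "(\<integral>\<^sup>+c. indicator S (T v c) \<partial>measure_pmf (C v)) =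
      (\<integral>\<^sup>+c. indicator {c. T v c \<in> S} c \<partial>measure_pmf (C v))" for v
    by (simp add: indicator_def)
  ultimately show ?thesis by simp
qed

text \<open>
  Common form of the joint laws of velocity, orbit and index and of their coupling. The map \<open>T\<close>
  can keep the parameter \<open>v\<close> as part of the outcome.
\<close>

definition pmf_mixture ::
    "'n measure \<Rightarrow> ('n \<Rightarrow> 'c pmf) \<Rightarrow> 'b measure \<Rightarrow> ('n \<Rightarrow> 'c \<Rightarrow> 'b) \<Rightarrow> 'b measure" where
  "pmf_mixture N C Q T = Giry_Monad.bind N (\<lambda>v. distr (measure_pmf (C v)) Q (T v))"

lemma pmf_mixture_map:
  assumes "\<And>v c. v \<in> space N \<Longrightarrow> T v c \<in> space Q"
  shows "pmf_mixture N (\<lambda>v. map_pmf f (C v)) Q T = pmf_mixture N C Q (\<lambda>v c. T v (f c))"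
  unfolding pmf_mixture_def using assms
  by (intro bind_cong refl) (simp add: map_pmf_rep_eq distr_distr o_def)

lemma pmf_mixture_cong:
  assumes "\<And>v. v \<in> space N \<Longrightarrow> C v = C' v" "sets Q = sets Q'"
    "\<And>v c. v \<in> space N \<Longrightarrow> T v c = T' v c"
  shows "pmf_mixture N C Q T = pmf_mixture N C' Q' T'"
  unfolding pmf_mixture_def using assms
  by (intro bind_cong refl) (auto intro!: distr_cong)

locale pmf_mixture_space = N: prob_space N for N :: "'n measure" +
  fixes C :: "'n \<Rightarrow> 'c pmf" and Q :: "'b measure" and T :: "'n \<Rightarrow> 'c \<Rightarrow> 'b"
  assumes kernel: "countable_kernel N C"
    and T: "\<And>c. (\<lambda>v. T v c) \<in> N \<rightarrow>\<^sub>M Q"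
begin

lemma T_pmf: "v \<in> space N \<Longrightarrow> T v \<in> measure_pmf (C v) \<rightarrow>\<^sub>M Q"
  using measurable_space[OF T] by auto

lemma measurable_kernel: "(\<lambda>v. distr (measure_pmf (C v)) Q (T v)) \<in> N \<rightarrow>\<^sub>M prob_algebra Q"
proof (rule measurable_prob_algebraI)
  show "prob_space (distr (measure_pmf (C v)) Q (T v))" if "v \<in> space N" for v
    by (rule prob_space.prob_space_distr[OF prob_space_measure_pmf T_pmf[OF that]])
  show "(\<lambda>v. distr (measure_pmf (C v)) Q (T v)) \<in> N \<rightarrow>\<^sub>M subprob_algebra Q"
  proof (rule measurable_subprob_algebra)
    show "subprob_space (distr (measure_pmf (C v)) Q (T v))" if "v \<in> space N" for v
      by (intro prob_space_imp_subprob_space prob_space.prob_space_distr[OF prob_space_measure_pmf T_pmf[OF that]])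
    fix S assume S: "S \<in> sets Q"
    have "(\<lambda>v. \<integral>\<^sup>+c. indicator S (T v c) \<partial>measure_pmf (C v)) \<in> borel_measurable N"
      by (intro borel_measurable_nn_integral_countable_kernel kernel measurable_compose[OF T])
        (use S in simp)
    moreover have "emeasure (distr (measure_pmf (C v)) Q (T v)) S = (\<integral>\<^sup>+c. indicator S (T v c) \<partial>measure_pmf (C v))"
      if "v \<in> space N" for v
      using nn_integral_distr[OF T_pmf[OF that], of "indicator S"] S by simp
    ultimately show "(\<lambda>v. emeasure (distr (measure_pmf (C v)) Q (T v)) S) \<in> borel_measurable N"
      by (simp cong: measurable_cong)
  qed simp
qed

lemma measurable_kernel_subprob:
  "(\<lambda>v. distr (measure_pmf (C v)) Q (T v)) \<in> N \<rightarrow>\<^sub>M subprob_algebra Q"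
  by (rule measurable_prob_algebraD[OF measurable_kernel])

lemma sets_mixture [simp, measurable_cong]: "sets (pmf_mixture N C Q T) = sets Q"
  unfolding pmf_mixture_def by (rule sets_bind) (simp_all add: N.not_empty)

lemma prob_space_mixture: "prob_space (pmf_mixture N C Q T)"
  unfolding pmf_mixture_def
  by (rule N.prob_space_bind[OF _ measurable_kernel_subprob])
    (auto intro!: prob_space.prob_space_distr[OF prob_space_measure_pmf] T_pmf)

lemma nn_integral_mixture:
  assumes "f \<in> borel_measurable Q"
  shows "(\<integral>\<^sup>+y. f y \<partial>pmf_mixture N C Q T) = (\<integral>\<^sup>+v. \<integral>\<^sup>+c. f (T v c) \<partial>measure_pmf (C v) \<partial>N)"
  unfolding pmf_mixture_def nn_integral_bind[OF assms measurable_kernel_subprob]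
  by (intro nn_integral_cong nn_integral_distr T_pmf) (simp_all add: assms)

lemma emeasure_mixture:
  assumes "S \<in> sets Q"
  shows "emeasure (pmf_mixture N C Q T) S = (\<integral>\<^sup>+v. emeasure (measure_pmf (C v)) {c. T v c \<in> S} \<partial>N)"
proof -
  have "emeasure (pmf_mixture N C Q T) S = (\<integral>\<^sup>+v. \<integral>\<^sup>+c. indicator S (T v c) \<partial>measure_pmf (C v) \<partial>N)"
    using nn_integral_mixture[of "indicator S"] assms by simp
  also have "(\<lambda>v. \<integral>\<^sup>+c. indicator S (T v c) \<partial>measure_pmf (C v)) =
      (\<lambda>v. \<integral>\<^sup>+c. indicator {c. T v c \<in> S} c \<partial>measure_pmf (C v))"
    by (simp add: indicator_def)
  finally show ?thesis by simp
qed

lemma distr_mixture: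
  assumes F: "F \<in> Q \<rightarrow>\<^sub>M R"
  shows "distr (pmf_mixture N C Q T) R F = pmf_mixture N C R (\<lambda>v c. F (T v c))"
  unfolding pmf_mixture_def distr_bind[OF measurable_kernel_subprob N.not_empty F]
  by (intro bind_cong refl) (simp add: distr_distr[OF F T_pmf] o_def)

end

text \<open>
  An additional random parameter \<open>w\<close> may be integrated out: it suffices to compare, for each
  fixed \<open>v\<close>, the average over \<open>w\<close> of the conditional law given \<open>(v, w)\<close> with the conditional law given \<open>v\<close>.
\<close>

lemma pmf_mixture_pair_eq:
  assumes M1: "prob_space M1" and M2: "prob_space M2"
    and C: "countable_kernel (M1 \<Otimes>\<^sub>M M2) C" and T: "\<And>c. (\<lambda>z. T z c) \<in> M1 \<Otimes>\<^sub>M M2 \<rightarrow>\<^sub>M Q"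
    and C': "countable_kernel M1 C'" and T': "\<And>c. (\<lambda>v. T' v c) \<in> M1 \<rightarrow>\<^sub>M Q"
    and eq: "\<And>v S. v \<in> space M1 \<Longrightarrow> S \<in> sets Q \<Longrightarrow>
      (\<integral>\<^sup>+w. emeasure (measure_pmf (C (v, w))) {c. T (v, w) c \<in> S} \<partial>M2) =
      emeasure (measure_pmf (C' v)) {c. T' v c \<in> S}"
  shows "pmf_mixture (M1 \<Otimes>\<^sub>M M2) C Q T = pmf_mixture M1 C' Q T'"
proof -
  interpret M1: prob_space M1 by fact
  interpret M2: prob_space M2 by fact
  interpret P: pair_prob_space M1 M2 ..
  interpret A: pmf_mixture_space "M1 \<Otimes>\<^sub>M M2" C Q T
    by unfold_locales (fact C T)+
  interpret B: pmf_mixture_space M1 C' Q T'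
    by unfold_locales (fact C' T')+
  show ?thesis
  proof (rule measure_eqI)
    fix S assume "S \<in> sets (pmf_mixture (M1 \<Otimes>\<^sub>M M2) C Q T)"
    then have S: "S \<in> sets Q" by simp
    have meas: "(\<lambda>z. emeasure (measure_pmf (C z)) {c. T z c \<in> S}) \<in> borel_measurable (M1 \<Otimes>\<^sub>M M2)"
    proof -
      have "(\<lambda>z. \<integral>\<^sup>+c. indicator S (T z c) \<partial>measure_pmf (C z)) \<in> borel_measurable (M1 \<Otimes>\<^sub>M M2)"
        by (intro borel_measurable_nn_integral_countable_kernel C measurable_compose[OF T])
          (use S in simp)
      moreover have "(\<integral>\<^sup>+c. indicator S (T z c) \<partial>measure_pmf (C z)) =
          (\<integral>\<^sup>+c. indicator {c. T z c \<in> S} c \<partial>measure_pmf (C z))" for z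
        by (simp add: indicator_def)
      ultimately show ?thesis by simp
    qed
    show "emeasure (pmf_mixture (M1 \<Otimes>\<^sub>M M2) C Q T) S = emeasure (pmf_mixture M1 C' Q T') S"
      unfolding A.emeasure_mixture[OF S] B.emeasure_mixture[OF S] M2.nn_integral_fst[OF meas, symmetric]
      by (intro nn_integral_cong eq S)
  qed simp
qed

text \<open>
  If the conditional law does not depend on \<open>w\<close>, then \<open>w\<close> is independent of \<open>(v, c)\<close>.
\<close>

lemma pmf_mixture_pair_snd:
  assumes M1: "prob_space M1" and M2: "prob_space M2"
    and C: "countable_kernel M1 C" and T: "\<And>c. (\<lambda>v. T v c) \<in> M1 \<rightarrow>\<^sub>M Q"
  shows "pmf_mixture (M1 \<Otimes>\<^sub>M M2) (\<lambda>(v, w). C v) (Q \<Otimes>\<^sub>M M2) (\<lambda>(v, w) c. (T v c, w)) =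
    pmf_mixture M1 C Q T \<Otimes>\<^sub>M M2"
proof -
  interpret M1: prob_space M1 by fact
  interpret M2: prob_space M2 by fact
  interpret P: pair_prob_space M1 M2 ..
  have kernel: "countable_kernel (M1 \<Otimes>\<^sub>M M2) (\<lambda>(v, w). C v)"
    unfolding case_prod_beta by (rule countable_kernel_compose[OF C measurable_fst])
  have map: "(\<lambda>z. (\<lambda>(v, w) c. (T v c, w)) z c) \<in> M1 \<Otimes>\<^sub>M M2 \<rightarrow>\<^sub>M Q \<Otimes>\<^sub>M M2" for c
    unfolding case_prod_beta
    by (intro measurable_Pair measurable_compose[OF measurable_fst T] measurable_snd)
  interpret A: pmf_mixture_space "M1 \<Otimes>\<^sub>M M2" "\<lambda>(v, w). C v" "Q \<Otimes>\<^sub>M M2" "\<lambda>(v, w) c. (T v c, w)"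
    by unfold_locales (fact kernel map)+
  interpret B: pmf_mixture_space M1 C Q T
    by unfold_locales (fact C T)+
  interpret BM: prob_space "pmf_mixture M1 C Q T" by (rule B.prob_space_mixture)
  show ?thesis
  proof (rule pair_measure_eqI[symmetric])
    fix A B assume "A \<in> sets (pmf_mixture M1 C Q T)" and B: "B \<in> sets M2"
    then have A: "A \<in> sets Q" by simp
    have meas: "(\<lambda>v. emeasure (measure_pmf (C v)) {c. T v c \<in> A}) \<in> borel_measurable M1"
      by (rule borel_measurable_emeasure_countable_kernel[OF C T A])
    have AB: "A \<times> B \<in> sets (Q \<Otimes>\<^sub>M M2)" using A B by simp
    have "emeasure (pmf_mixture (M1 \<Otimes>\<^sub>M M2) (\<lambda>(v, w). C v) (Q \<Otimes>\<^sub>M M2) (\<lambda>(v, w) c. (T v c, w))) (A \<times> B) =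
        (\<integral>\<^sup>+z. emeasure (measure_pmf (C (fst z))) {c. T (fst z) c \<in> A} * indicator B (snd z) \<partial>(M1 \<Otimes>\<^sub>M M2))"
      unfolding A.emeasure_mixture[OF AB]
      by (intro nn_integral_cong) (auto simp: case_prod_beta split: split_indicator)
    also have "\<dots> = (\<integral>\<^sup>+v. \<integral>\<^sup>+w. emeasure (measure_pmf (C v)) {c. T v c \<in> A} * indicator B w \<partial>M2 \<partial>M1)"
      using meas B by (subst M2.nn_integral_fst[symmetric]) auto
    also have "\<dots> = (\<integral>\<^sup>+v. emeasure (measure_pmf (C v)) {c. T v c \<in> A} * emeasure M2 B \<partial>M1)"
      using B by (intro nn_integral_cong) (simp add: nn_integral_cmult)
    also have "\<dots> = emeasure (pmf_mixture M1 C Q T) A * emeasure M2 B"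
      using meas by (simp add: nn_integral_multc B.emeasure_mixture[OF A])
    finally show "emeasure (pmf_mixture M1 C Q T) A * emeasure M2 B =
        emeasure (pmf_mixture (M1 \<Otimes>\<^sub>M M2) (\<lambda>(v, w). C v) (Q \<Otimes>\<^sub>M M2) (\<lambda>(v, w) c. (T v c, w))) (A \<times> B)" ..
  qed (simp_all add: BM.sigma_finite_measure_axioms M2.sigma_finite_measure_axioms cong: sets_pair_measure_cong)
qed

section \<open>Gaussian tails\<close>

lemma space_std_gaussian [simp]: "space std_gaussian = UNIV"
  and sets_std_gaussian [simp, measurable_cong]: "sets std_gaussian = sets borel"
  by (simp_all add: std_gaussian_def)

lemma norm_sq_eq_sum_Basis:
  fixes v :: "'a::euclidean_space"
  shows "(norm v)\<^sup>2 = (\<Sum>b\<in>Basis. (v \<bullet> b)\<^sup>2)"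
  unfolding power2_norm_eq_inner euclidean_inner[of v v] by (simp add: power2_eq_square)

text \<open>
  The coordinates of a standard Gaussian vector are independent and standard normal.
\<close>

lemma nn_integral_std_gaussian_prod:
  fixes f :: "'a::euclidean_space \<Rightarrow> real \<Rightarrow> real"
  assumes [measurable]: "\<And>b. b \<in> Basis \<Longrightarrow> f b \<in> borel_measurable borel"
    and nonneg: "\<And>b y. b \<in> Basis \<Longrightarrow> 0 \<le> f b y"
  shows "(\<integral>\<^sup>+v. ennreal (\<Prod>b\<in>Basis. f b (v \<bullet> b)) \<partial>(std_gaussian :: 'a measure)) =
    (\<Prod>b\<in>Basis. \<integral>\<^sup>+y. ennreal (f b y * std_normal_density y) \<partial>lborel)"
proof -
  have dens: "exp (- (norm v)\<^sup>2 / 2) / sqrt (2 * pi) ^ DIM('a) = (\<Prod>b\<in>Basis. std_normal_density (v \<bullet> b))"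
    for v :: 'a
  proof -
    have "(\<Prod>b\<in>Basis. std_normal_density (v \<bullet> b)) =
        (\<Prod>b\<in>(Basis :: 'a set). 1 / sqrt (2 * pi)) * (\<Prod>b\<in>Basis. exp (- (v \<bullet> b)\<^sup>2 / 2))"
      by (simp only: std_normal_density_def prod.distrib)
    also have "(\<Prod>b\<in>Basis. exp (- (v \<bullet> b)\<^sup>2 / 2)) = exp (- (norm v)\<^sup>2 / 2)"
      by (simp add: norm_sq_eq_sum_Basis sum_negf sum_divide_distrib flip: exp_sum)
    finally show ?thesis by (simp add: power_divide)
  qed
  have "(\<integral>\<^sup>+v. ennreal (\<Prod>b\<in>Basis. f b (v \<bullet> b)) \<partial>(std_gaussian :: 'a measure)) =
      (\<integral>\<^sup>+v. ennreal (exp (- (norm v)\<^sup>2 / 2) / sqrt (2 * pi) ^ DIM('a)) * ennreal (\<Prod>b\<in>Basis. f b (v \<bullet> b)) \<partial>lborel)"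
    unfolding std_gaussian_def by (rule nn_integral_density) measurable
  also have "\<dots> = (\<integral>\<^sup>+v. (\<Prod>b\<in>Basis. ennreal (f b (v \<bullet> b) * std_normal_density (v \<bullet> b))) \<partial>(lborel :: 'a measure))"
    unfolding dens
    by (intro nn_integral_cong)
      (simp add: nonneg prod_ennreal prod_nonneg prod.distrib ennreal_mult'[symmetric] mult.commute)
  also have "\<dots> = (\<Prod>b\<in>Basis. \<integral>\<^sup>+y. ennreal (f b y * std_normal_density y) \<partial>lborel)"
    by (rule nn_integral_lborel_prod) (simp_all add: nonneg)
  finally show ?thesis .
qed

lemma nn_integral_normal_density:
  assumes "0 < \<sigma>"
  shows "(\<integral>\<^sup>+y. ennreal (normal_density \<mu> \<sigma> y) \<partial>lborel) = 1"
  using assms by (subst nn_integral_eq_integral) auto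

lemma prob_space_std_gaussian: "prob_space (std_gaussian :: 'a::euclidean_space measure)"
proof
  have "(\<integral>\<^sup>+v. 1 \<partial>(std_gaussian :: 'a measure)) = 1"
    using nn_integral_std_gaussian_prod[of "\<lambda>_::'a. \<lambda>_. 1"]
    by (simp add: nn_integral_normal_density)
  then show "emeasure (std_gaussian :: 'a measure) (space std_gaussian) = 1" by simp
qed

text \<open>
  Coordinatewise, up to a constant, the factor \<open>exp (c y)\<close> shifts the standard normal density to
  mean \<open>c\<close>.
\<close>

lemma std_gaussian_mgf_inner:
  fixes x :: "'a::euclidean_space"
  shows "(\<integral>\<^sup>+v. ennreal (exp (x \<bullet> v)) \<partial>std_gaussian) = ennreal (exp ((norm x)\<^sup>2 / 2))"
proof -
  have shift: "(\<integral>\<^sup>+y. ennreal (exp (c * y) * std_normal_density y) \<partial>lborel) = ennreal (exp (c\<^sup>2 / 2))" for c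
  proof -
    have "exp (c * y) * std_normal_density y = exp (c\<^sup>2 / 2) * normal_density c 1 y" for y
      by (simp add: normal_density_def field_simps power2_eq_square flip: exp_add)
    then have "(\<integral>\<^sup>+y. ennreal (exp (c * y) * std_normal_density y) \<partial>lborel) =
        (\<integral>\<^sup>+y. ennreal (exp (c\<^sup>2 / 2)) * ennreal (normal_density c 1 y) \<partial>lborel)"
      by (simp add: ennreal_mult')
    also have "\<dots> = ennreal (exp (c\<^sup>2 / 2))"
      by (subst nn_integral_cmult) (simp_all add: nn_integral_normal_density)
    finally show ?thesis .
  qed
  have "exp (x \<bullet> v) = (\<Prod>b\<in>Basis. exp ((x \<bullet> b) * (v \<bullet> b)))" for v
    by (simp add: euclidean_inner[of x v] exp_sum)
  then have "(\<integral>\<^sup>+v. ennreal (exp (x \<bullet> v)) \<partial>std_gaussian) = (\<Prod>b\<in>Basis. ennreal (exp ((x \<bullet> b)\<^sup>2 / 2)))"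
    using nn_integral_std_gaussian_prod[of "\<lambda>b y. exp ((x \<bullet> b) * y)"] by (simp add: shift)
  also have "\<dots> = ennreal (exp ((norm x)\<^sup>2 / 2))"
    by (simp add: prod_ennreal norm_sq_eq_sum_Basis exp_sum sum_divide_distrib)
  finally show ?thesis .
qed

text \<open>
  The derivative of \<open>ln (1 + u) - u + u^2\<close> is \<open>u (1 + 2 u) / (1 + u)\<close>, which has the sign of \<open>u\<close> for
  \<open>u \<ge> - 1/2\<close>.
\<close>

lemma ln_one_plus_ge_quadratic:
  fixes u :: real
  assumes "\<bar>u\<bar> \<le> 1 / 2"
  shows "u - u\<^sup>2 \<le> ln (1 + u)"
proof -
  let ?f = "\<lambda>u::real. ln (1 + u) - u + u\<^sup>2"
  have deriv: "(?f has_real_derivative (t * (1 + 2 * t) / (1 + t))) (at t)" if "- (1 / 2) \<le> t" for t :: real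
    using that by (auto intro!: derivative_eq_intros simp: field_simps power2_eq_square)
  have "?f 0 \<le> ?f u"
  proof (cases "0 \<le> u")
    case True
    then show ?thesis
    proof (rule DERIV_nonneg_imp_nondecreasing)
      fix t :: real assume "0 \<le> t"
      then show "\<exists>y. (?f has_real_derivative y) (at t) \<and> 0 \<le> y"
        by (intro exI[of _ "t * (1 + 2 * t) / (1 + t)"] conjI deriv) auto
    qed
  next
    case False
    then have "u \<le> 0" by simp
    then show ?thesis
    proof (rule DERIV_nonpos_imp_nonincreasing)
      fix t assume "u \<le> t" "t \<le> 0"
      then have "t * (1 + 2 * t) / (1 + t) \<le> 0"
        using assms by (intro divide_nonpos_nonneg mult_nonpos_nonneg) auto
      then show "\<exists>y. (?f has_real_derivative y) (at t) \<and> y \<le> 0"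
        using deriv[of t] \<open>u \<le> t\<close> assms by (intro exI[of _ "t * (1 + 2 * t) / (1 + t)"]) linarith
    qed
  qed
  then show ?thesis by simp
qed

text \<open>
  Coordinatewise, up to a constant, the factor \<open>exp (\<tau> y^2)\<close> gives the standard normal density variance
  \<open>1 / (1 - 2 \<tau>)\<close>, so the exponential moment is the \<open>d\<close>-th power of \<open>exp (- \<tau>) (1 - 2 \<tau>) powr (- 1/2)\<close>.
  The logarithm of this base is at most \<open>2 \<tau>^2\<close> by the preceding lemma with \<open>u = - 2 \<tau>\<close>.
\<close>

lemma std_gaussian_mgf_norm_sq:
  assumes "\<bar>\<tau>\<bar> \<le> 1 / 4"
  shows "(\<integral>\<^sup>+v. ennreal (exp (\<tau> * ((norm v)\<^sup>2 - real DIM('a)))) \<partial>(std_gaussian :: 'a::euclidean_space measure))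
    \<le> ennreal (exp (2 * \<tau>\<^sup>2 * real DIM('a)))"
proof -
  define \<sigma> where "\<sigma> = 1 / sqrt (1 - 2 * \<tau>)"
  have pos: "0 < 1 - 2 * \<tau>" using assms by auto
  then have \<sigma>: "0 < \<sigma>" "\<sigma>\<^sup>2 = 1 / (1 - 2 * \<tau>)" by (simp_all add: \<sigma>_def power_divide)
  have "- (2 * \<tau>) - (2 * \<tau>)\<^sup>2 \<le> ln (1 + - (2 * \<tau>))"
    using ln_one_plus_ge_quadratic[of "- (2 * \<tau>)"] assms by simp
  then have "- \<tau> - ln (1 - 2 * \<tau>) / 2 \<le> 2 * \<tau>\<^sup>2" by (simp add: power2_eq_square)
  moreover have "\<sigma> = exp (- (ln (1 - 2 * \<tau>) / 2))"
    using pos by (simp add: \<sigma>_def exp_minus inverse_eq_divide ln_sqrt[symmetric])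
  ultimately have le: "exp (- \<tau>) * \<sigma> \<le> exp (2 * \<tau>\<^sup>2)"
    by (simp flip: exp_add)
  have scale: "(\<integral>\<^sup>+y. ennreal (exp (\<tau> * (y\<^sup>2 - 1)) * std_normal_density y) \<partial>lborel) = ennreal (exp (- \<tau>) * \<sigma>)"
  proof -
    have "exp (\<tau> * (y\<^sup>2 - 1)) * std_normal_density y = exp (- \<tau>) * \<sigma> * normal_density 0 \<sigma> y" for y
    proof -
      have "- y\<^sup>2 / (2 * \<sigma>\<^sup>2) = \<tau> * y\<^sup>2 - y\<^sup>2 / 2"
        using pos by (simp add: \<sigma> field_simps)
      then have "normal_density 0 \<sigma> y = 1 / (sqrt (2 * pi) * \<sigma>) * exp (\<tau> * y\<^sup>2 - y\<^sup>2 / 2)"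
        using \<sigma>(1) by (simp add: normal_density_def real_sqrt_mult del: minus_divide_left)
      moreover have "exp (\<tau> * (y\<^sup>2 - 1)) * exp (- y\<^sup>2 / 2) = exp (- \<tau>) * exp (\<tau> * y\<^sup>2 - y\<^sup>2 / 2)"
        by (simp add: algebra_simps flip: exp_add)
      ultimately show ?thesis
        using \<sigma>(1) by (simp add: std_normal_density_def)
    qed
    then have "(\<integral>\<^sup>+y. ennreal (exp (\<tau> * (y\<^sup>2 - 1)) * std_normal_density y) \<partial>lborel) =
        (\<integral>\<^sup>+y. ennreal (exp (- \<tau>) * \<sigma>) * ennreal (normal_density 0 \<sigma> y) \<partial>lborel)"
      using \<sigma> by (simp add: ennreal_mult')
    also have "\<dots> = ennreal (exp (- \<tau>) * \<sigma>)"
      using \<sigma> by (subst nn_integral_cmult) (simp_all add: nn_integral_normal_density)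
    finally show ?thesis .
  qed
  have "exp (\<tau> * ((norm v)\<^sup>2 - real DIM('a))) = (\<Prod>b\<in>Basis. exp (\<tau> * ((v \<bullet> b)\<^sup>2 - 1)))" for v :: 'a
    by (simp add: norm_sq_eq_sum_Basis sum_subtractf flip: exp_sum sum_distrib_left)
  then have "(\<integral>\<^sup>+v. ennreal (exp (\<tau> * ((norm v)\<^sup>2 - real DIM('a)))) \<partial>(std_gaussian :: 'a measure)) =
      (\<Prod>b\<in>(Basis::'a set). ennreal (exp (- \<tau>) * \<sigma>))"
    using nn_integral_std_gaussian_prod[of "\<lambda>_::'a. \<lambda>y. exp (\<tau> * (y\<^sup>2 - 1))"] by (simp add: scale)
  also have "\<dots> = ennreal ((exp (- \<tau>) * \<sigma>) ^ DIM('a))"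
    using \<sigma> by (simp add: ennreal_power)
  also have "\<dots> \<le> ennreal (exp (2 * \<tau>\<^sup>2) ^ DIM('a))"
    using le \<sigma> by (intro ennreal_leI power_mono) auto
  also have "exp (2 * \<tau>\<^sup>2) ^ DIM('a) = exp (2 * \<tau>\<^sup>2 * real DIM('a))"
    by (simp add: exp_of_nat2_mult)
  finally show ?thesis .
qed

lemma chernoff_bound:
  assumes [measurable]: "Y \<in> borel_measurable M"
    and mgf: "(\<integral>\<^sup>+v. ennreal (exp (Y v)) \<partial>M) \<le> ennreal (exp a)"
  shows "emeasure M {v \<in> space M. r \<le> Y v} \<le> ennreal (exp (a - r))"
proof -
  have "emeasure M {v \<in> space M. r \<le> Y v} = (\<integral>\<^sup>+v. indicator {v \<in> space M. r \<le> Y v} v \<partial>M)"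
    by simp
  also have "\<dots> \<le> (\<integral>\<^sup>+v. ennreal (exp (- r)) * ennreal (exp (Y v)) \<partial>M)"
    by (intro nn_integral_mono) (auto simp: indicator_def simp flip: ennreal_mult exp_add)
  also have "\<dots> = ennreal (exp (- r)) * (\<integral>\<^sup>+v. ennreal (exp (Y v)) \<partial>M)"
    by (rule nn_integral_cmult) measurable
  also have "\<dots> \<le> ennreal (exp (- r)) * ennreal (exp a)"
    by (intro mult_left_mono mgf) simp
  also have "\<dots> = ennreal (exp (a - r))"
    by (simp add: algebra_simps flip: ennreal_mult exp_add)
  finally show ?thesis .
qed

lemma velocity_event_measurable [measurable]: "velocity_event r x \<in> sets borel"
  unfolding velocity_event_def by measurable

text \<open>
  Four one-sided Chernoff bounds, for both signs of \<open>|v|^2 - d\<close> and of \<open>x \<bullet> v\<close>. The exponents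
  \<open>r / (4 d)\<close> and \<open>r / (2 d)\<close> are optimal for the moment bounds at hand; the first one is at most \<open>1 / 4\<close>
  because \<open>r \<le> d\<close>.
\<close>

lemma std_gaussian_velocity_event:
  fixes x :: "'a::euclidean_space"
  assumes r: "0 \<le> r" "r \<le> real DIM('a)" and x: "(norm x)\<^sup>2 \<le> 2 * real DIM('a)"
  shows "emeasure std_gaussian (- velocity_event r x) \<le> ennreal (4 * exp (- r\<^sup>2 / (8 * real DIM('a))))"
proof -
  define d where "d = real DIM('a)"
  let ?G = "std_gaussian :: 'a measure" and ?B = "ennreal (exp (- r\<^sup>2 / (8 * d)))"
  have d: "0 < d" by (simp add: d_def)
  have rd: "r * r / d \<ge> 0" using d by simp
  have shell: "emeasure ?G {v. r \<le> c * ((norm v)\<^sup>2 - d)} \<le> ?B" if "c = 1 \<or> c = -1" for c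
  proof -
    define \<tau> where "\<tau> = c * r / (4 * d)"
    have c: "c * c = 1" using that by auto
    have "\<bar>\<tau>\<bar> \<le> 1 / 4" using that r d by (auto simp: \<tau>_def d_def field_simps)
    from std_gaussian_mgf_norm_sq[OF this, where 'a = 'a, folded d_def]
    have "emeasure ?G {v \<in> space ?G. r / (4 * d) * r \<le> \<tau> * ((norm v)\<^sup>2 - d)} \<le>
        ennreal (exp (2 * \<tau>\<^sup>2 * d - r / (4 * d) * r))"
      by (intro chernoff_bound) auto
    also have "2 * \<tau>\<^sup>2 * d - r / (4 * d) * r = - r\<^sup>2 / (8 * d)"
      using d c by (auto simp: \<tau>_def field_simps power2_eq_square)
    finally have *: "emeasure ?G {v \<in> space ?G. r / (4 * d) * r \<le> \<tau> * ((norm v)\<^sup>2 - d)} \<le> ?B" .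
    have "emeasure ?G {v. r \<le> c * ((norm v)\<^sup>2 - d)} \<le>
        emeasure ?G {v \<in> space ?G. r / (4 * d) * r \<le> \<tau> * ((norm v)\<^sup>2 - d)}"
    proof (intro emeasure_mono subsetI)
      fix v :: 'a assume "v \<in> {v. r \<le> c * ((norm v)\<^sup>2 - d)}"
      then have "r / (4 * d) * r \<le> r / (4 * d) * (c * ((norm v)\<^sup>2 - d))"
        using r d by (intro mult_left_mono) auto
      then show "v \<in> {v \<in> space ?G. r / (4 * d) * r \<le> \<tau> * ((norm v)\<^sup>2 - d)}"
        by (simp add: \<tau>_def mult_ac)
    qed simp
    with * show ?thesis by (rule order_trans[rotated])
  qed
  have inner: "emeasure ?G {v. r \<le> c * (x \<bullet> v)} \<le> ?B" if "c = 1 \<or> c = -1" for c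
  proof -
    define t where "t = c * r / (2 * d)"
    have c: "c * c = 1" using that by auto
    have "(norm (t *\<^sub>R x))\<^sup>2 / 2 = t\<^sup>2 * (norm x)\<^sup>2 / 2" by (simp add: power_mult_distrib)
    also have "\<dots> \<le> t\<^sup>2 * (2 * d) / 2"
      using x by (intro divide_right_mono mult_left_mono) (auto simp: d_def)
    also have "\<dots> = r\<^sup>2 / (4 * d)"
      using d c by (auto simp: t_def field_simps power2_eq_square)
    finally have "(\<integral>\<^sup>+v. ennreal (exp ((t *\<^sub>R x) \<bullet> v)) \<partial>?G) \<le> ennreal (exp (r\<^sup>2 / (4 * d)))"
      unfolding std_gaussian_mgf_inner by (intro ennreal_leI) simp
    then have "emeasure ?G {v \<in> space ?G. r / (2 * d) * r \<le> (t *\<^sub>R x) \<bullet> v} \<le>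
        ennreal (exp (r\<^sup>2 / (4 * d) - r / (2 * d) * r))"
      by (intro chernoff_bound) auto
    also have "\<dots> \<le> ?B"
      using d rd by (intro ennreal_leI) (auto simp: field_simps power2_eq_square)
    finally have *: "emeasure ?G {v \<in> space ?G. r / (2 * d) * r \<le> (t *\<^sub>R x) \<bullet> v} \<le> ?B" .
    have "emeasure ?G {v. r \<le> c * (x \<bullet> v)} \<le>
        emeasure ?G {v \<in> space ?G. r / (2 * d) * r \<le> (t *\<^sub>R x) \<bullet> v}"
    proof (intro emeasure_mono subsetI)
      fix v :: 'a assume "v \<in> {v. r \<le> c * (x \<bullet> v)}"
      then have "r / (2 * d) * r \<le> r / (2 * d) * (c * (x \<bullet> v))"
        using r d by (intro mult_left_mono) auto
      then show "v \<in> {v \<in> space ?G. r / (2 * d) * r \<le> (t *\<^sub>R x) \<bullet> v}"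
        by (simp add: t_def mult_ac)
    qed simp
    with * show ?thesis by (rule order_trans[rotated])
  qed
  let ?S = "\<lambda>c::real. {v::'a. r \<le> c * ((norm v)\<^sup>2 - d)}" and ?I = "\<lambda>c::real. {v. r \<le> c * (x \<bullet> v)}"
  have "emeasure ?G (- velocity_event r x) \<le> emeasure ?G ((?S 1 \<union> ?S (-1)) \<union> (?I 1 \<union> ?I (-1)))"
    by (intro emeasure_mono) (auto simp: velocity_event_def d_def abs_if not_le split: if_splits)
  also have "\<dots> \<le> emeasure ?G (?S 1 \<union> ?S (-1)) + emeasure ?G (?I 1 \<union> ?I (-1))"
    by (intro emeasure_subadditive) auto
  also have "\<dots> \<le> (emeasure ?G (?S 1) + emeasure ?G (?S (-1))) + (emeasure ?G (?I 1) + emeasure ?G (?I (-1)))"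
    by (intro add_mono emeasure_subadditive) auto
  also have "\<dots> \<le> (?B + ?B) + (?B + ?B)"
    by (intro add_mono shell inner) auto
  also have "\<dots> = ennreal (4 * exp (- r\<^sup>2 / (8 * d)))"
    by (simp flip: ennreal_plus)
  finally show ?thesis by (simp add: d_def)
qed

section \<open>Residual laws\<close>

text \<open>
  If \<open>p\<close> times \<open>P\<close> is dominated by \<open>Q\<close>, a sample of \<open>Q\<close> can be drawn by tossing a coin: with probability
  \<open>p\<close> sample from \<open>P\<close>, otherwise from this law. For \<open>p = 1\<close> the second branch is never taken, and
  the value \<open>Q\<close> is an arbitrary choice.
\<close>

definition residual_pmf :: "real \<Rightarrow> 'a pmf \<Rightarrow> 'a pmf \<Rightarrow> 'a pmf" where
  "residual_pmf p P Q =
     (if p < 1 then embed_pmf (\<lambda>i. (pmf Q i - p * pmf P i) / (1 - p)) else Q)"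

lemma pmf_residual_pmf:
  assumes "\<And>i. p * pmf P i \<le> pmf Q i"
  shows "pmf (residual_pmf p P Q) i = (if p < 1 then (pmf Q i - p * pmf P i) / (1 - p) else pmf Q i)"
proof (cases "p < 1")
  case True
  let ?f = "\<lambda>i. (pmf Q i - p * pmf P i) / (1 - p)"
  have nonneg: "0 \<le> ?f i" for i using assms[of i] True by simp
  have "(\<integral>\<^sup>+i. ennreal (?f i) \<partial>count_space UNIV) = ennreal (\<integral>i. ?f i \<partial>count_space UNIV)"
    by (rule nn_integral_eq_integral) (auto intro!: AE_I2 nonneg integrable_divide_zero
        Bochner_Integration.integrable_diff integrable_mult_right integrable_pmf)
  also have "(\<integral>i. ?f i \<partial>count_space UNIV) = 1"
    using True by (simp add: integrable_pmf integral_pmf Bochner_Integration.integral_diff)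
  finally have "pmf (embed_pmf ?f) i = ?f i"
    using nonneg by (intro pmf_embed_pmf) simp_all
  then show ?thesis using True by (simp add: residual_pmf_def)
qed (simp add: residual_pmf_def)

text \<open>
  For \<open>p = 1\<close> the domination of a probability by another one forces equality, by comparing a set and
  its complement.
\<close>

lemma measure_residual_pmf:
  assumes le: "\<And>i. p * pmf P i \<le> pmf Q i" and p: "p \<le> 1"
  shows "measure Q S = p * measure P S + (1 - p) * measure (residual_pmf p P Q) S"
proof (cases "p < 1")
  case True
  have "measure (residual_pmf p P Q) S = (\<integral>i. (pmf Q i - p * pmf P i) / (1 - p) \<partial>count_space S)"
    using True by (simp add: pmf_residual_pmf[OF le] flip: integral_pmf)
  also have "\<dots> = (measure Q S - p * measure P S) / (1 - p)"
    by (simp add: integrable_pmf integral_pmf Bochner_Integration.integral_diff)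
  finally show ?thesis using True by simp
next
  case False
  then have p1: "p = 1" using p by simp
  have mono: "measure P S \<le> measure Q S" for S
    unfolding integral_pmf[symmetric] using le p1 by (intro integral_mono integrable_pmf) auto
  have "measure P (- S) = 1 - measure P S" "measure Q (- S) = 1 - measure Q S"
    using measure_pmf.prob_compl[of S P] measure_pmf.prob_compl[of S Q] by (simp_all add: Compl_eq_Diff_UNIV)
  then have "measure Q S = measure P S" using mono[of S] mono[of "- S"] by simp
  then show ?thesis using p1 by simp
qed

lemma countable_kernel_residual_pmf:
  assumes P: "countable_kernel N P" and Q: "countable_kernel N Q"
    and [measurable]: "p \<in> borel_measurable N"
    and le: "\<And>v i. p v * pmf (P v) i \<le> pmf (Q v) i"
  shows "countable_kernel N (\<lambda>v. residual_pmf (p v) (P v) (Q v))"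
  unfolding countable_kernel_def
proof (intro conjI allI)
  have [measurable]: "(\<lambda>v. pmf (P v) c) \<in> borel_measurable N" "(\<lambda>v. pmf (Q v) c) \<in> borel_measurable N" for c
    using P Q by (auto simp: countable_kernel_def)
  show "(\<lambda>v. pmf (residual_pmf (p v) (P v) (Q v)) c) \<in> borel_measurable N" for c
    unfolding pmf_residual_pmf[OF le] by measurable
  show "countable (\<Union>v\<in>space N. set_pmf (residual_pmf (p v) (P v) (Q v)))"
  proof (rule countable_subset)
    show "(\<Union>v\<in>space N. set_pmf (residual_pmf (p v) (P v) (Q v))) \<subseteq>
        (\<Union>v\<in>space N. set_pmf (P v)) \<union> (\<Union>v\<in>space N. set_pmf (Q v))"
      by (auto simp: set_pmf_eq pmf_residual_pmf[OF le] split: if_splits)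
  qed (use P Q in \<open>auto simp: countable_kernel_def\<close>)
qed

section \<open>Measurable dependence on the velocity\<close>

lemma leapfrog_iter_measurable:
  fixes x :: "'a::euclidean_space"
  assumes "0 < h" "h \<le> 1"
  shows "(\<lambda>v. fst (leapfrog_iter h i (x, v))) \<in> borel_measurable borel"
    and "(\<lambda>v. snd (leapfrog_iter h i (x, v))) \<in> borel_measurable borel"
  by (simp_all add: leapfrog_iter_eq_elliptic_rotation[OF assms] elliptic_rotation_def)

lemma uturn_measurable:
  fixes x :: "'a::euclidean_space"
  assumes "0 < h" "h \<le> 1"
  shows "Measurable.pred borel (\<lambda>v. uturn h (x, v) I)"
proof -
  define f g where "f i v = fst (leapfrog_iter h i (x, v))" and "g i v = snd (leapfrog_iter h i (x, v))" for i v
  have [measurable]: "f i \<in> borel_measurable borel" "g i \<in> borel_measurable borel" for i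
    unfolding f_def[abs_def] g_def[abs_def] by (rule leapfrog_iter_measurable[OF assms])+
  have "uturn h (x, v) I \<longleftrightarrow> g (Max I) v \<bullet> (f (Max I) v - f (Min I) v) < 0 \<or>
      g (Min I) v \<bullet> (f (Max I) v - f (Min I) v) < 0" for v
    by (simp add: uturn_def case_prod_beta f_def g_def)
  then show ?thesis by simp
qed

lemma sub_uturn_measurable:
  fixes x :: "'a::euclidean_space"
  assumes "0 < h" "h \<le> 1"
  shows "Measurable.pred borel (\<lambda>v. sub_uturn h (x, v) I)"
proof -
  note [measurable] = uturn_measurable[OF assms]
  show ?thesis unfolding sub_uturn_def by measurable
qed

lemma index_weight_measurable:
  fixes x :: "'a::euclidean_space"
  assumes "0 < h" "h \<le> 1"
  shows "(\<lambda>v. index_weight h (x, v) i) \<in> borel_measurable borel"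
proof -
  define f g where "f v = fst (leapfrog_iter h i (x, v))" and "g v = snd (leapfrog_iter h i (x, v))" for v
  have [measurable]: "f \<in> borel_measurable borel" "g \<in> borel_measurable borel"
    unfolding f_def[abs_def] g_def[abs_def] by (rule leapfrog_iter_measurable[OF assms])+
  have "index_weight h (x, v) i =
      exp (- ((norm (f v))\<^sup>2 / 2 + (norm (g v))\<^sup>2 / 2 - ((norm x)\<^sup>2 / 2 + (norm v)\<^sup>2 / 2)))" for v
    by (simp add: index_weight_def energy_def case_prod_beta f_def g_def)
  then show ?thesis by simp
qed

lemma index_level_measurable:
  fixes x :: "'a::euclidean_space"
  assumes h: "0 < h" "h \<le> 1"
  shows "(\<lambda>v. index_level h x v I) \<in> borel_measurable borel"
proof (cases "finite I")
  case True
  note [measurable] = index_weight_measurable[OF h]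
  have [measurable]: "(\<lambda>v. MIN i\<in>I. index_weight h (x, v) i) \<in> borel_measurable borel"
    by (rule borel_measurable_Min[OF True]) measurable
  show ?thesis unfolding index_level_def by measurable
qed (simp add: index_level_def)

text \<open>
  There are uncountably many sets of integers, so measurability for each fixed \<open>I\<close> is not enough.
  However, \<open>card\<close> makes the level zero on every infinite set, just as on the empty set, and
  there are only countably many finite sets.
\<close>

lemma index_level_pair_measurable:
  fixes x :: "'a::euclidean_space"
  assumes h: "0 < h" "h \<le> 1"
  shows "(\<lambda>(v, I). index_level h x v I) \<in> borel_measurable (borel \<Otimes>\<^sub>M count_space UNIV)"
proof -
  let ?fin = "\<lambda>I :: int set. if finite I then I else {}"
  have "?fin \<circ> snd \<in> borel \<Otimes>\<^sub>M count_space UNIV \<rightarrow>\<^sub>M count_space (Collect finite)"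
    by (rule measurable_comp[OF measurable_snd]) simp
  moreover have "countable (Collect finite :: int set set)" by (rule countable_Collect_finite)
  ultimately have "(\<lambda>z. index_level h x (fst z) ((?fin \<circ> snd) z)) \<in> borel_measurable ((borel :: 'a measure) \<Otimes>\<^sub>M count_space UNIV)"
    by (intro measurable_compose_countable'[where I = "Collect finite" and g = "?fin \<circ> snd"
          and f = "\<lambda>I z. index_level h x (fst z) I"]
        measurable_compose[OF measurable_fst index_level_measurable[OF h]])
  moreover have "index_level h x v (?fin I) = index_level h x v I" for v I
    by (simp add: index_level_def)
  ultimately show ?thesis by (simp add: case_prod_beta o_def del: if_image_distrib)
qed

lemma good_event_measurable:
  fixes x :: "'a::euclidean_space"
  assumes h: "0 < h" "h \<le> 1" and [measurable]: "E \<in> sets borel"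
  shows "good_event h x E \<in> sets ((borel \<Otimes>\<^sub>M count_space UNIV) \<Otimes>\<^sub>M borel)"
proof -
  note [measurable] = index_level_pair_measurable[OF h, unfolded case_prod_beta]
  have "good_event h x E = {z \<in> space ((borel \<Otimes>\<^sub>M count_space UNIV) \<Otimes>\<^sub>M borel).
      fst (fst z) \<in> E \<and> snd z \<le> index_level h x (fst (fst z)) (snd (fst z))}"
    by (auto simp: good_event_def space_pair_measure)
  then show ?thesis by simp
qed

lemma endpoint_measurable:
  fixes x :: "'a::euclidean_space"
  assumes h: "0 < h" "h \<le> 1"
  shows "(\<lambda>(v, I, L). endpoint h x v L) \<in> borel_measurable (draw_space :: ('a \<times> int set \<times> int) measure)"
proof -
  have "(\<lambda>z. endpoint h x (fst z) (snd (snd z))) \<in> borel_measurable (draw_space :: ('a \<times> int set \<times> int) measure)"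
    unfolding endpoint_def
    by (rule measurable_compose_countable[where g = "\<lambda>z. snd (snd z)" and
          f = "\<lambda>i z. fst (leapfrog_iter h i (x, fst z))"])
      (intro measurable_compose[OF measurable_fst leapfrog_iter_measurable(1)[OF h]], measurable)
  then show ?thesis by (simp add: case_prod_beta)
qed

lemma set_select_orbit:
  assumes "finite I" "I \<noteq> {}"
  shows "finite (set_pmf (select_orbit h z n I))"
    and "J \<in> set_pmf (select_orbit h z n I) \<Longrightarrow> finite J \<and> J \<noteq> {}"
proof -
  have "finite (set_pmf (select_orbit h z n I)) \<and>
      (\<forall>J\<in>set_pmf (select_orbit h z n I). finite J \<and> J \<noteq> {})"
    using assms
  proof (induction n arbitrary: I)
    case (Suc n)
    define T where "T = {(\<lambda>i. i - int (card I)) ` I, (\<lambda>i. i + int (card I)) ` I}"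
    define S where "S I' = insert I (insert (I \<union> I') (set_pmf (select_orbit h z n (I \<union> I'))))" for I'
    have T: "finite T" "set_pmf (pmf_of_set T) = T"
      unfolding T_def by simp (rule set_pmf_of_set, simp_all)
    have sub: "set_pmf (select_orbit h z (Suc n) I) \<subseteq> (\<Union>I'\<in>T. S I')"
    proof
      fix J assume "J \<in> set_pmf (select_orbit h z (Suc n) I)"
      then obtain I' where I': "I' \<in> T"
        and J: "J \<in> set_pmf (if sub_uturn h z I' then return_pmf I
          else if uturn h z (I \<union> I') then return_pmf (I \<union> I')
          else select_orbit h z n (I \<union> I'))"
        unfolding select_orbit.simps set_bind_pmf T_def[symmetric] T(2) by blast
      have "J \<in> set_pmf (if a then return_pmf I else if b then return_pmf K else p) \<Longrightarrow>
          J \<in> insert I (insert K (set_pmf p))" for a b K and p :: "int set pmf"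
        by (cases a; cases b) simp_all
      from this[OF J] have "J \<in> S I'" unfolding S_def .
      with I' show "J \<in> (\<Union>I'\<in>T. S I')" by blast
    qed
    have S: "finite (S I') \<and> (\<forall>J\<in>S I'. finite J \<and> J \<noteq> {})" if "I' \<in> T" for I'
    proof -
      have "finite I'" using that Suc.prems by (auto simp: T_def)
      with Suc.prems have "finite (I \<union> I')" "I \<union> I' \<noteq> {}" by auto
      from Suc.IH[OF this] Suc.prems \<open>finite I'\<close> show ?thesis by (simp add: S_def)
    qed
    have "finite (\<Union>I'\<in>T. S I')" using S T(1) by blast
    then have "finite (set_pmf (select_orbit h z (Suc n) I))" by (rule finite_subset[OF sub])
    moreover have "finite J \<and> J \<noteq> {}" if "J \<in> set_pmf (select_orbit h z (Suc n) I)" for J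
      using that sub S by blast
    ultimately show ?case by blast
  qed simp
  then show "finite (set_pmf (select_orbit h z n I))"
    and "J \<in> set_pmf (select_orbit h z n I) \<Longrightarrow> finite J \<and> J \<noteq> {}"
    by auto
qed

lemma set_orbit_law:
  shows "finite (set_pmf (orbit_law h kmax z))"
    and "I \<in> set_pmf (orbit_law h kmax z) \<Longrightarrow> finite I"
    and "I \<in> set_pmf (orbit_law h kmax z) \<Longrightarrow> I \<noteq> {}"
  unfolding orbit_law_def
  using set_select_orbit[where I = "{0}" and h = h and z = z and n = kmax] by blast+

lemma countable_kernel_select_orbit:
  fixes x :: "'a::euclidean_space"
  assumes h: "0 < h" "h \<le> 1"
  shows "countable_kernel borel (\<lambda>v. select_orbit h (x, v) n I)"
proof (induction n arbitrary: I)
  case 0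
  then show ?case by (simp add: countable_kernel_const)
next
  case (Suc n)
  show ?case
    unfolding select_orbit.simps
    by (intro countable_kernel_bind countable_kernel_const countable_kernel_if Suc
        uturn_measurable sub_uturn_measurable h)
qed

lemma pmf_index_pmf:
  assumes I: "finite I" "I \<noteq> {}"
  shows "pmf (index_pmf h z I) i =
    (if i \<in> I then index_weight h z i / (\<Sum>j\<in>I. index_weight h z j) else 0)"
proof -
  let ?w = "index_weight h z"
  have pos: "0 < sum ?w I"
    using I by (intro sum_pos) (auto simp: index_weight_pos)
  have "(\<integral>\<^sup>+i. ennreal (if i \<in> I then ?w i / sum ?w I else 0) \<partial>count_space UNIV) =
      (\<Sum>i\<in>I. ennreal (?w i / sum ?w I))"
    using I by (subst nn_integral_count_space'[of I]) (auto simp: index_weight_pos pos)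
  also have "\<dots> = ennreal (\<Sum>i\<in>I. ?w i / sum ?w I)"
    using pos by (intro sum_ennreal) (auto intro!: divide_nonneg_pos less_imp_le[OF index_weight_pos])
  also have "(\<Sum>i\<in>I. ?w i / sum ?w I) = 1"
    using pos by (simp flip: sum_divide_distrib)
  finally show ?thesis
    unfolding index_pmf_def using pos
    by (subst pmf_embed_pmf) (auto intro!: divide_nonneg_pos less_imp_le[OF index_weight_pos])
qed

lemma countable_kernel_index_pmf:
  fixes x :: "'a::euclidean_space"
  assumes h: "0 < h" "h \<le> 1" and I: "finite I" "I \<noteq> {}"
  shows "countable_kernel borel (\<lambda>v. index_pmf h (x, v) I)"
  unfolding countable_kernel_def
proof (intro conjI allI)
  note [measurable] = index_weight_measurable[OF h]
  show "countable (\<Union>v\<in>space borel. set_pmf (index_pmf h (x, v) I))"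
    by (rule countable_subset[of _ I]) (use I in \<open>auto simp: set_pmf_eq pmf_index_pmf countable_finite\<close>)
  show "(\<lambda>v. pmf (index_pmf h (x, v) I) i) \<in> borel_measurable borel" for i
    unfolding pmf_index_pmf[OF I] by measurable
qed

text \<open>
  The uniform law on \<open>I\<close> times the level is the constant function with value the smallest index
  probability.
\<close>

lemma index_level_dominates:
  assumes I: "finite I" "I \<noteq> {}"
  shows "index_level h x v I * pmf (pmf_of_set I) i \<le> pmf (index_pmf h (x, v) I) i"
proof -
  have "0 < (\<Sum>j\<in>I. index_weight h (x, v) j)"
    using I by (intro sum_pos) (auto simp: index_weight_pos)
  moreover have "0 < real (card I)" using I by (simp add: card_gt_0_iff)
  ultimately show ?thesis
    using I by (auto simp: pmf_index_pmf index_level_def indicator_def field_simps)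
qed

lemma countable_kernel_orbit_law:
  fixes x :: "'a::euclidean_space"
  assumes "0 < h" "h \<le> 1"
  shows "countable_kernel borel (\<lambda>v. orbit_law h kmax (x, v))"
  unfolding orbit_law_def by (rule countable_kernel_select_orbit[OF assms])

section \<open>Coupling of the two transitions\<close>

lemma nuts_choice_eq_dependent_pair:
  "nuts_choice h kmax x v = dependent_pair_pmf (orbit_law h kmax (x, v)) (index_pmf h (x, v))"
  by (simp add: nuts_choice_def dependent_pair_pmf_def)

lemma draw_law_eq_pmf_mixture:
  "draw_law C = pmf_mixture std_gaussian C draw_space (\<lambda>v (I, L). (v, I, L))"
  by (simp add: draw_law_def pmf_mixture_def)

lemma pmf_mixture_space_nuts_draws:
  fixes x :: "'a::euclidean_space"
  assumes h: "0 < h" "h \<le> 1"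
  shows "pmf_mixture_space std_gaussian (nuts_choice h kmax x) draw_space (\<lambda>v (I, L). (v, I, L))"
proof -
  interpret prob_space "std_gaussian :: 'a measure" by (rule prob_space_std_gaussian)
  show ?thesis
  proof
    have "countable_kernel (borel :: 'a measure) (nuts_choice h kmax x)"
      unfolding nuts_choice_eq_dependent_pair[abs_def]
      by (intro countable_kernel_dependent_pair countable_kernel_orbit_law countable_kernel_index_pmf h)
        (blast dest: set_orbit_law(2,3))+
    then show "countable_kernel (std_gaussian :: 'a measure) (nuts_choice h kmax x)"
      by (rule countable_kernel_sets_cong) simp
    show "(\<lambda>v. (\<lambda>(I, L). (v, I, L)) c) \<in> (std_gaussian :: 'a measure) \<rightarrow>\<^sub>M draw_space" for c
      by (cases c) simp
  qed
qed

lemma emeasure_uniform_greaterThan: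
  fixes p :: real
  assumes p: "0 \<le> p" "p \<le> 1"
  shows "emeasure (uniform_measure lborel {0..1}) {p<..} = ennreal (1 - p)"
proof -
  have "{0..1} \<inter> {p<..} = {p<..1}" using p by auto
  then show ?thesis using p by (simp add: emeasure_uniform_measure divide_ennreal_def)
qed

lemma nn_integral_uniform_threshold:
  assumes p: "0 \<le> p" "p \<le> 1"
  shows "(\<integral>\<^sup>+w. (if w \<le> p then a else b) \<partial>uniform_measure lborel {0..1::real}) =
    ennreal p * a + ennreal (1 - p) * b"
proof -
  let ?U = "uniform_measure lborel {0..1::real}"
  have lo: "emeasure ?U {..p} = ennreal p"
  proof -
    have "{0..1} \<inter> {..p} = {0..p}" using p by auto
    then show ?thesis using p by (simp add: emeasure_uniform_measure divide_ennreal_def)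
  qed
  note up = emeasure_uniform_greaterThan[OF p]
  have "(\<integral>\<^sup>+w. (if w \<le> p then a else b) \<partial>?U) =
      (\<integral>\<^sup>+w. a * indicator {..p} w + b * indicator {p<..} w \<partial>?U)"
    by (intro nn_integral_cong) (auto split: split_indicator)
  also have "\<dots> = a * ennreal p + b * ennreal (1 - p)"
    by (subst nn_integral_add) (simp_all add: nn_integral_cmult_indicator lo up)
  finally show ?thesis by (simp add: mult.commute)
qed

text \<open>
  The law of the index given \<open>W = w\<close>: the event \<open>w \<le> index_level h x v I\<close> is the outcome of the coin that
  selects the uniform part of the index law.
\<close>

definition index_coin_pmf :: "real \<Rightarrow> 'a::euclidean_space \<Rightarrow> 'a \<Rightarrow> real \<Rightarrow> int set \<Rightarrow> int pmf" where
  "index_coin_pmf h x v w I =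
     (if w \<le> index_level h x v I then pmf_of_set I
      else residual_pmf (index_level h x v I) (pmf_of_set I) (index_pmf h (x, v) I))"

lemma nn_integral_index_coin:
  assumes I: "finite I" "I \<noteq> {}"
  shows "(\<integral>\<^sup>+w. emeasure (index_coin_pmf h x v w I) S \<partial>uniform_measure lborel {0..1}) =
    emeasure (index_pmf h (x, v) I) S"
proof -
  let ?p = "index_level h x v I" and ?R = "residual_pmf (index_level h x v I) (pmf_of_set I) (index_pmf h (x, v) I)"
  have p: "0 \<le> ?p" "?p \<le> 1" using index_level_nonneg[OF I] index_level_le_1[OF I] .
  have "(\<integral>\<^sup>+w. emeasure (index_coin_pmf h x v w I) S \<partial>uniform_measure lborel {0..1}) =
      (\<integral>\<^sup>+w. (if w \<le> ?p then emeasure (pmf_of_set I) S else emeasure ?R S) \<partial>uniform_measure lborel {0..1})"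
    by (intro nn_integral_cong) (simp add: index_coin_pmf_def)
  also have "\<dots> = ennreal ?p * emeasure (pmf_of_set I) S + ennreal (1 - ?p) * emeasure ?R S"
    by (rule nn_integral_uniform_threshold[OF p])
  also have "\<dots> = ennreal (?p * measure (pmf_of_set I) S + (1 - ?p) * measure ?R S)"
    using p by (simp add: measure_pmf.emeasure_eq_measure ennreal_mult ennreal_plus)
  also have "\<dots> = ennreal (measure (index_pmf h (x, v) I) S)"
    by (subst measure_residual_pmf[where p = ?p and P = "pmf_of_set I"])
      (simp_all only: index_level_dominates[OF I] p)
  finally show ?thesis by (simp add: measure_pmf.emeasure_eq_measure)
qed

text \<open>
  Averaging over \<open>w\<close> restores the index law on each orbit. The orbit law does not depend on \<open>w\<close> and has
  finite support, which allows the two averages to be interchanged.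
\<close>

lemma nn_integral_orbit_index_coin:
  "(\<integral>\<^sup>+w. emeasure (dependent_pair_pmf (orbit_law h kmax (x, v)) (index_coin_pmf h x v w)) S
      \<partial>uniform_measure lborel {0..1}) = emeasure (nuts_choice h kmax x v) S"
proof -
  let ?U = "uniform_measure lborel {0..1::real}" and ?O = "orbit_law h kmax (x, v)"
  note O = set_orbit_law[where h = h and kmax = kmax and z = "(x, v)"]
  have meas: "(\<lambda>w. emeasure (index_coin_pmf h x v w I) T) \<in> borel_measurable ?U" for I T
    unfolding index_coin_pmf_def if_distrib[where f = "\<lambda>p. emeasure (measure_pmf p) T"] by measurable
  have "(\<integral>\<^sup>+w. emeasure (dependent_pair_pmf ?O (index_coin_pmf h x v w)) S \<partial>?U) =
      (\<integral>\<^sup>+w. (\<Sum>I\<in>set_pmf ?O. emeasure (index_coin_pmf h x v w I) {L. (I, L) \<in> S} * ennreal (pmf ?O I)) \<partial>?U)"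
    by (simp add: emeasure_dependent_pair_pmf nn_integral_measure_pmf_finite O(1))
  also have "\<dots> = (\<Sum>I\<in>set_pmf ?O.
      (\<integral>\<^sup>+w. emeasure (index_coin_pmf h x v w I) {L. (I, L) \<in> S} \<partial>?U) * ennreal (pmf ?O I))"
    using meas by (simp add: nn_integral_sum nn_integral_multc)
  also have "\<dots> = (\<Sum>I\<in>set_pmf ?O. emeasure (index_pmf h (x, v) I) {L. (I, L) \<in> S} * ennreal (pmf ?O I))"
    by (intro sum.cong refl arg_cong2[where f = "(*)"] nn_integral_index_coin O)
  also have "\<dots> = emeasure (nuts_choice h kmax x v) S"
    by (simp add: nuts_choice_eq_dependent_pair emeasure_dependent_pair_pmf
        nn_integral_measure_pmf_finite O(1))
  finally show ?thesis .
qed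

text \<open>
  Joint law of \<open>(I, L, I', L')\<close> given the velocity \<open>v\<close> and the uniform variable \<open>w\<close>. For \<open>v \<in> E\<close> both
  transitions use the same orbit; otherwise they are independent. The index \<open>L'\<close> is only a fallback:
  in the coupling it is replaced by \<open>L\<close> on the good event.
\<close>

definition coupled_choice ::
    "real \<Rightarrow> nat \<Rightarrow> nat \<Rightarrow> 'a::euclidean_space \<Rightarrow> 'a set \<Rightarrow> 'a \<Rightarrow> real \<Rightarrow>
      (int set \<times> int \<times> int set \<times> int) pmf" where
  "coupled_choice h kmax k x E v w =
     dependent_pair_pmf (orbit_law h kmax (x, v)) (\<lambda>I.
       dependent_pair_pmf (index_coin_pmf h x v w I) (\<lambda>L.
         if v \<in> E then map_pmf (Pair I) (pmf_of_set I) else unif_choice k))"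

lemma map_coupled_choice_nuts:
  "map_pmf (\<lambda>(I, L, c). (I, L)) (coupled_choice h kmax k x E v w) =
    dependent_pair_pmf (orbit_law h kmax (x, v)) (index_coin_pmf h x v w)"
proof -
  have "(\<lambda>(I, L, c). (I, L)) = (\<lambda>(I::int set, z). (I, fst (z :: int \<times> int set \<times> int)))" by auto
  then show ?thesis
    unfolding coupled_choice_def by (simp only: map_dependent_pair_pmf map_fst_dependent_pair_pmf)
qed

lemma map_coupled_choice_orbit:
  "map_pmf fst (coupled_choice h kmax k x E v w) = orbit_law h kmax (x, v)"
  unfolding coupled_choice_def by (rule map_fst_dependent_pair_pmf)

text \<open>
  For \<open>v \<in> E\<close>, whatever \<open>w\<close> is, the second index is uniform on the orbit: below the level it equals \<open>L\<close>,
  which is uniform there, and above the level it equals the fallback.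
\<close>

lemma map_coupled_choice_unif:
  assumes "v \<in> E \<Longrightarrow> orbit_law h kmax (x, v) = pmf_of_set (index_orbits0 k)"
  shows "map_pmf (\<lambda>(I, L, I', L'). (I', if v \<in> E \<and> w \<le> index_level h x v I then L else L'))
    (coupled_choice h kmax k x E v w) = unif_choice k"
proof (cases "v \<in> E")
  case True
  have *: "map_pmf (\<lambda>(L, I', L'). (I', if w \<le> index_level h x v I then L else L'))
      (dependent_pair_pmf (index_coin_pmf h x v w I) (\<lambda>L. map_pmf (Pair I) (pmf_of_set I))) =
      map_pmf (Pair I) (pmf_of_set I)" for I
    by (simp add: dependent_pair_pmf_def map_bind_pmf pmf.map_comp o_def index_coin_pmf_def map_pmf_const)
      (simp add: map_pmf_def)
  show ?thesis
    unfolding unif_choice_def assms[OF True, symmetric]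
    unfolding coupled_choice_def dependent_pair_pmf_def[of "orbit_law h kmax (x, v)"] map_bind_pmf
    using *[unfolded case_prod_beta'] True by (simp add: pmf.map_comp o_def case_prod_beta' cong: if_cong)
next
  case False
  then show ?thesis
    by (simp add: coupled_choice_def dependent_pair_pmf_def map_bind_pmf pmf.map_comp o_def case_prod_beta)
qed

lemma nuts_velocity_orbit_law:
  fixes x :: "'a::euclidean_space"
  assumes h: "0 < h" "h \<le> 1"
  shows "distr (nuts_draws h kmax x) (borel \<Otimes>\<^sub>M count_space UNIV) (\<lambda>(v, I, L). (v, I)) =
    pmf_mixture std_gaussian (\<lambda>v. orbit_law h kmax (x, v)) (borel \<Otimes>\<^sub>M count_space UNIV) Pair"
proof -
  let ?Q = "(borel :: 'a measure) \<Otimes>\<^sub>M (count_space UNIV :: int set measure)"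
  interpret N: pmf_mixture_space "std_gaussian :: 'a measure" "nuts_choice h kmax x" draw_space
      "\<lambda>v (I, L). (v, I, L)"
    by (rule pmf_mixture_space_nuts_draws[OF h])
  have "(\<lambda>(v, I, L). (v, I)) \<in> draw_space \<rightarrow>\<^sub>M ?Q"
    unfolding case_prod_beta' by measurable
  then have "distr (nuts_draws h kmax x) ?Q (\<lambda>(v, I, L). (v, I)) =
      pmf_mixture std_gaussian (nuts_choice h kmax x) ?Q (\<lambda>v c. (v, fst c))"
    unfolding draw_law_eq_pmf_mixture
    by (subst N.distr_mixture) (simp_all add: case_prod_beta')
  also have "\<dots> = pmf_mixture std_gaussian (\<lambda>v. map_pmf fst (nuts_choice h kmax x v)) ?Q Pair"
    by (rule pmf_mixture_map[symmetric]) (simp add: space_pair_measure)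
  finally show ?thesis
    by (simp add: nuts_choice_eq_dependent_pair map_fst_dependent_pair_pmf)
qed

text \<open>
  The coordinates are \<open>(V, I, L, I', L', W)\<close>, where \<open>L'\<close> is still the fallback index.
\<close>

abbreviation outcome_space :: "('a::euclidean_space \<times> int set \<times> int \<times> int set \<times> int \<times> real) measure" where
  "outcome_space \<equiv> borel \<Otimes>\<^sub>M count_space UNIV \<Otimes>\<^sub>M count_space UNIV \<Otimes>\<^sub>M count_space UNIV \<Otimes>\<^sub>M
     count_space UNIV \<Otimes>\<^sub>M borel"

lemma countable_kernel_coupled_choice:
  fixes x :: "'a::euclidean_space"
  assumes h: "0 < h" "h \<le> 1" and [measurable]: "E \<in> sets borel"
  shows "countable_kernel (borel \<Otimes>\<^sub>M borel) (\<lambda>(v, w). coupled_choice h kmax k x E v w)"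
proof -
  let ?B = "(borel :: 'a measure) \<Otimes>\<^sub>M (borel :: real measure)"
  have orbit: "countable_kernel ?B (\<lambda>z. orbit_law h kmax (x, fst z))"
    by (rule countable_kernel_compose[OF countable_kernel_orbit_law[OF h] measurable_fst])
  have level: "(\<lambda>z. index_level h x (fst z) I) \<in> borel_measurable ?B" for I
    by (rule measurable_compose[OF measurable_fst index_level_measurable[OF h]])
  note [measurable] = level
  have coin: "countable_kernel ?B (\<lambda>z. index_coin_pmf h x (fst z) (snd z) I)"
    if I: "finite I" "I \<noteq> {}" for I
    unfolding index_coin_pmf_def
    by (intro countable_kernel_if countable_kernel_const countable_kernel_residual_pmf level
        countable_kernel_compose[OF countable_kernel_index_pmf[OF h I] measurable_fst]
        index_level_dominates[OF I]) measurable
  show ?thesis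
    unfolding coupled_choice_def case_prod_beta
    by (intro countable_kernel_dependent_pair orbit coin countable_kernel_if countable_kernel_const)
      (erule set_orbit_law(2), erule set_orbit_law(3), measurable)
qed

text \<open>
  The base space carries the velocity and the uniform \<open>W\<close>, independent of each other; orbits and
  indices are added by the kernel \<open>coupled_choice\<close>. The law of \<open>(V, I, L)\<close> is right after averaging
  over \<open>W\<close>, the law of \<open>(V, I', L')\<close> for every value of \<open>W\<close>, and the law of \<open>I\<close> given \<open>(V, W)\<close> is free of \<open>W\<close>,
  which makes \<open>W\<close> independent of \<open>(V, I)\<close>.
\<close>

lemma nuts_follows_unif_hmc_onI:
  fixes x :: "'a::euclidean_space"
  assumes h: "0 < h" "h \<le> 1" and E: "E \<in> sets borel"
    and orbit: "\<And>v. v \<in> E \<Longrightarrow> orbit_law h kmax (x, v) = pmf_of_set (index_orbits0 k)"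
  shows "nuts_follows_unif_hmc_on h kmax k x (good_event h x E)"
proof -
  let ?G = "std_gaussian :: 'a measure" and ?U = "uniform_measure lborel {0..1::real}"
  define C where "C z = coupled_choice h kmax k x E (fst z) (snd z)" for z
  define T where "T z c = (fst z, fst c, fst (snd c), fst (snd (snd c)), snd (snd (snd c)), snd z)"
    for z :: "'a \<times> real" and c :: "int set \<times> int \<times> int set \<times> int"
  have G: "prob_space ?G" by (rule prob_space_std_gaussian)
  have U: "prob_space ?U" by (rule prob_space_uniform_measure) simp_all
  interpret GU: pair_prob_space ?G ?U
    by (intro pair_prob_space.intro pair_sigma_finite.intro prob_space_imp_sigma_finite G U)
  have sets_GU: "sets (borel \<Otimes>\<^sub>M borel) = sets (?G \<Otimes>\<^sub>M ?U)"
    by (intro sets_pair_measure_cong) simp_all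
  have C: "countable_kernel (?G \<Otimes>\<^sub>M ?U) C"
    using countable_kernel_sets_cong[OF
        countable_kernel_coupled_choice[OF h E, where kmax = kmax and k = k and x = x] sets_GU]
    by (simp only: C_def[abs_def] case_prod_beta')
  have fst_snd [measurable]: "fst \<in> ?G \<Otimes>\<^sub>M ?U \<rightarrow>\<^sub>M borel" "snd \<in> ?G \<Otimes>\<^sub>M ?U \<rightarrow>\<^sub>M borel"
    using measurable_fst[of ?G ?U] measurable_snd[of ?G ?U] by (simp_all cong: measurable_cong_sets)
  interpret M: pmf_mixture_space "?G \<Otimes>\<^sub>M ?U" C outcome_space T
  proof
    show "countable_kernel (?G \<Otimes>\<^sub>M ?U) C" by (rule C)
    show "(\<lambda>z. T z c) \<in> ?G \<Otimes>\<^sub>M ?U \<rightarrow>\<^sub>M outcome_space" for c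
      unfolding T_def by measurable
  qed
  define M where "M = pmf_mixture (?G \<Otimes>\<^sub>M ?U) C outcome_space T"
  define V :: "'a \<times> int set \<times> int \<times> int set \<times> int \<times> real \<Rightarrow> 'a"
    where "V \<omega> = fst \<omega>" for \<omega>
  define I where "I \<omega> = fst (snd \<omega>)"
    for \<omega> :: "'a \<times> int set \<times> int \<times> int set \<times> int \<times> real"
  define L where "L \<omega> = fst (snd (snd \<omega>))"
    for \<omega> :: "'a \<times> int set \<times> int \<times> int set \<times> int \<times> real"
  define I' where "I' \<omega> = fst (snd (snd (snd \<omega>)))"
    for \<omega> :: "'a \<times> int set \<times> int \<times> int set \<times> int \<times> real"
  define W where "W \<omega> = snd (snd (snd (snd (snd \<omega>))))"
    for \<omega> :: "'a \<times> int set \<times> int \<times> int set \<times> int \<times> real"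
  define L0 where "L0 \<omega> = fst (snd (snd (snd (snd \<omega>))))"
    for \<omega> :: "'a \<times> int set \<times> int \<times> int set \<times> int \<times> real"
  \<comment> \<open>Overwriting the fallback index makes the transitions agree at every point of the good event,
    not only almost surely.\<close>
  define L' where "L' \<omega> = (if ((V \<omega>, I \<omega>), W \<omega>) \<in> good_event h x E then L \<omega> else L0 \<omega>)" for \<omega>
  have VILI: "V \<in> borel_measurable outcome_space" "I \<in> outcome_space \<rightarrow>\<^sub>M count_space UNIV"
    "L \<in> outcome_space \<rightarrow>\<^sub>M count_space UNIV" "I' \<in> outcome_space \<rightarrow>\<^sub>M count_space UNIV"
    "W \<in> borel_measurable outcome_space" "L0 \<in> outcome_space \<rightarrow>\<^sub>M count_space UNIV"
    unfolding V_def[abs_def] I_def[abs_def] L_def[abs_def] I'_def[abs_def] W_def[abs_def] L0_def[abs_def]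
    by measurable
  note [measurable] = VILI good_event_measurable[OF h E]
  have L'm [measurable]: "L' \<in> outcome_space \<rightarrow>\<^sub>M count_space UNIV"
    unfolding L'_def[abs_def] by measurable
  have sets_M: "sets M = sets outcome_space"
    unfolding M_def by (rule M.sets_mixture)
  note meas = measurable_cong_sets[OF sets_M refl]
  have meas_draw: "(\<lambda>\<omega>. (V \<omega>, I \<omega>, L \<omega>)) \<in> outcome_space \<rightarrow>\<^sub>M draw_space"
    "(\<lambda>\<omega>. (V \<omega>, I' \<omega>, L' \<omega>)) \<in> outcome_space \<rightarrow>\<^sub>M draw_space"
    "(\<lambda>\<omega>. ((V \<omega>, I \<omega>), W \<omega>)) \<in> outcome_space \<rightarrow>\<^sub>M (borel \<Otimes>\<^sub>M count_space UNIV) \<Otimes>\<^sub>M borel"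
    by measurable
  have nuts: "distr M draw_space (\<lambda>\<omega>. (V \<omega>, I \<omega>, L \<omega>)) = nuts_draws h kmax x"
    unfolding M_def M.distr_mixture[OF meas_draw(1)] draw_law_eq_pmf_mixture
  proof (rule pmf_mixture_pair_eq[OF G U C])
    interpret N: pmf_mixture_space ?G "nuts_choice h kmax x" draw_space "\<lambda>v (I, L). (v, I, L)"
      by (rule pmf_mixture_space_nuts_draws[OF h])
    show "countable_kernel ?G (nuts_choice h kmax x)" by (rule N.kernel)
    show "(\<lambda>v. case c of (I, L) \<Rightarrow> (v, I, L)) \<in> ?G \<rightarrow>\<^sub>M draw_space" for c by (rule N.T)
    show "(\<lambda>z. (V (T z c), I (T z c), L (T z c))) \<in> ?G \<Otimes>\<^sub>M ?U \<rightarrow>\<^sub>M draw_space" for c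
      by (rule measurable_compose[OF M.T meas_draw(1)])
    fix v :: 'a and S :: "('a \<times> int set \<times> int) set"
    let ?S = "{(I, L). (v, I, L) \<in> S}"
    have "emeasure (C (v, w)) {c. (V (T (v, w) c), I (T (v, w) c), L (T (v, w) c)) \<in> S} =
        emeasure (map_pmf (\<lambda>(I, L, c). (I, L)) (coupled_choice h kmax k x E v w)) ?S" for w
      by (auto simp: C_def T_def V_def I_def L_def case_prod_beta intro!: arg_cong2[where f = emeasure])
    then show "(\<integral>\<^sup>+w. emeasure (C (v, w)) {c. (V (T (v, w) c), I (T (v, w) c), L (T (v, w) c)) \<in> S} \<partial>?U) =
        emeasure (nuts_choice h kmax x v) {c. (case c of (I, L) \<Rightarrow> (v, I, L)) \<in> S}"
      by (simp only: map_coupled_choice_nuts nn_integral_orbit_index_coin)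
        (auto intro!: arg_cong2[where f = emeasure])
  qed
  have unif: "distr M draw_space (\<lambda>\<omega>. (V \<omega>, I' \<omega>, L' \<omega>)) = unif_draws k"
    unfolding M_def M.distr_mixture[OF meas_draw(2)] draw_law_eq_pmf_mixture
  proof (rule pmf_mixture_pair_eq[OF G U C])
    show "countable_kernel ?G (\<lambda>_. unif_choice k)" by (rule countable_kernel_const)
    show "(\<lambda>v. case c of (I, L) \<Rightarrow> (v, I, L)) \<in> ?G \<rightarrow>\<^sub>M draw_space" for c by (cases c) simp
    show "(\<lambda>z. (V (T z c), I' (T z c), L' (T z c))) \<in> ?G \<Otimes>\<^sub>M ?U \<rightarrow>\<^sub>M draw_space" for c
      by (rule measurable_compose[OF M.T meas_draw(2)])
    fix v :: 'a and S :: "('a \<times> int set \<times> int) set"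
    let ?S = "{(I, L). (v, I, L) \<in> S}"
    have "emeasure (C (v, w)) {c. (V (T (v, w) c), I' (T (v, w) c), L' (T (v, w) c)) \<in> S} =
        emeasure (map_pmf (\<lambda>(I, L, I', L'). (I', if v \<in> E \<and> w \<le> index_level h x v I then L else L'))
          (coupled_choice h kmax k x E v w)) ?S" for w
      by (auto simp: C_def T_def V_def I_def L_def I'_def L'_def L0_def W_def good_event_def case_prod_beta
          intro!: arg_cong2[where f = emeasure])
    then show "(\<integral>\<^sup>+w. emeasure (C (v, w)) {c. (V (T (v, w) c), I' (T (v, w) c), L' (T (v, w) c)) \<in> S} \<partial>?U) =
        emeasure (unif_choice k) {c. (case c of (I, L) \<Rightarrow> (v, I, L)) \<in> S}"
      by (simp only: map_coupled_choice_unif[OF orbit] nn_integral_const GU.M2.emeasure_space_1 mult_1_right)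
        (auto intro!: arg_cong2[where f = emeasure])
  qed
  have select: "distr M ((borel \<Otimes>\<^sub>M count_space UNIV) \<Otimes>\<^sub>M borel) (\<lambda>\<omega>. ((V \<omega>, I \<omega>), W \<omega>)) =
      nuts_selection_law h kmax x"
  proof -
    let ?P = "borel \<Otimes>\<^sub>M count_space UNIV :: ('a \<times> int set) measure"
    have "distr M (?P \<Otimes>\<^sub>M borel) (\<lambda>\<omega>. ((V \<omega>, I \<omega>), W \<omega>)) =
        pmf_mixture (?G \<Otimes>\<^sub>M ?U) C (?P \<Otimes>\<^sub>M borel) (\<lambda>z c. ((fst z, fst c), snd z))"
      unfolding M_def M.distr_mixture[OF meas_draw(3)] by (simp add: V_def I_def W_def T_def)
    also have "\<dots> = pmf_mixture (?G \<Otimes>\<^sub>M ?U) (\<lambda>z. map_pmf fst (C z)) (?P \<Otimes>\<^sub>M borel)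
        (\<lambda>z I. ((fst z, I), snd z))"
      by (rule pmf_mixture_map[symmetric]) (simp add: space_pair_measure)
    also have "\<dots> = pmf_mixture (?G \<Otimes>\<^sub>M ?U) (\<lambda>(v, w). orbit_law h kmax (x, v)) (?P \<Otimes>\<^sub>M ?U)
        (\<lambda>(v, w) I. ((v, I), w))"
      by (rule pmf_mixture_cong)
        (auto simp: C_def map_coupled_choice_orbit case_prod_beta intro!: sets_pair_measure_cong)
    also have "\<dots> = pmf_mixture ?G (\<lambda>v. orbit_law h kmax (x, v)) ?P Pair \<Otimes>\<^sub>M ?U"
      by (rule pmf_mixture_pair_snd[OF G U])
        (simp_all add: countable_kernel_sets_cong[OF countable_kernel_orbit_law[OF h]])
    also have "\<dots> = nuts_selection_law h kmax x"
      by (simp add: nuts_selection_law_def nuts_velocity_orbit_law[OF h])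
    finally show ?thesis .
  qed
  have endpoint: "distr M borel (\<lambda>\<omega>. endpoint h x (V \<omega>) (J \<omega>)) =
      distr (distr M draw_space (\<lambda>\<omega>. (V \<omega>, K \<omega>, J \<omega>))) borel (\<lambda>(v, I, L). endpoint h x v L)"
    if "(\<lambda>\<omega>. (V \<omega>, K \<omega>, J \<omega>)) \<in> outcome_space \<rightarrow>\<^sub>M draw_space" for J K
    using that by (simp add: distr_distr[OF endpoint_measurable[OF h]] meas o_def)
  show ?thesis
    unfolding nuts_follows_unif_hmc_on_def
  proof (intro exI conjI ballI impI)
    show "prob_space M" unfolding M_def by (rule M.prob_space_mixture)
    show "distr M draw_space (\<lambda>\<omega>. (V \<omega>, I \<omega>, L \<omega>)) = nuts_draws h kmax x" by (rule nuts)
    show "distr M draw_space (\<lambda>\<omega>. (V \<omega>, I' \<omega>, L' \<omega>)) = unif_draws k" by (rule unif)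
    show "distr M ((borel \<Otimes>\<^sub>M count_space UNIV) \<Otimes>\<^sub>M borel) (\<lambda>\<omega>. ((V \<omega>, I \<omega>), W \<omega>)) =
      nuts_selection_law h kmax x" by (rule select)
    show "(\<lambda>\<omega>. endpoint h x (V \<omega>) (L \<omega>)) = (\<lambda>\<omega>. endpoint h x (V \<omega>) (L \<omega>))"
      "(\<lambda>\<omega>. endpoint h x (V \<omega>) (L' \<omega>)) = (\<lambda>\<omega>. endpoint h x (V \<omega>) (L' \<omega>))" by simp_all
    show "distr M borel (\<lambda>\<omega>. endpoint h x (V \<omega>) (L \<omega>)) = nuts_kernel h kmax x"
      unfolding endpoint[OF meas_draw(1)] nuts nuts_kernel_def ..
    show "distr M borel (\<lambda>\<omega>. endpoint h x (V \<omega>) (L' \<omega>)) = unif_hmc_kernel h k x"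
      unfolding endpoint[OF meas_draw(2)] unif unif_hmc_kernel_def ..
    show "endpoint h x (V \<omega>) (L \<omega>) = endpoint h x (V \<omega>) (L' \<omega>)"
      if "((V \<omega>, I \<omega>), W \<omega>) \<in> good_event h x E" for \<omega>
      using that by (simp add: L'_def)
  qed (simp_all only: meas VILI L'm)
qed

lemma nuts_follows_unif_hmc_on_mono:
  assumes "nuts_follows_unif_hmc_on h kmax k x B" "A \<subseteq> B"
  shows "nuts_follows_unif_hmc_on h kmax k x A"
  using assms unfolding nuts_follows_unif_hmc_on_def
  by (elim ex_forward conj_forward) (assumption | (rule ballI, drule (1) bspec, blast))+

section \<open>Rejection probability and identification with Uniform HMC\<close>

lemma velocity_event_bounds:
  fixes x v :: "'a::euclidean_space"
  assumes "x \<in> shell \<alpha>" "v \<in> velocity_event r x"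
  shows "\<bar>(norm x)\<^sup>2 - real DIM('a)\<bar> \<le> max \<alpha> r"
    "\<bar>(norm v)\<^sup>2 - real DIM('a)\<bar> \<le> max \<alpha> r" "\<bar>x \<bullet> v\<bar> \<le> max \<alpha> r"
  using assms by (auto simp: shell_def velocity_event_def)

text \<open>
  Given \<open>(v, I)\<close>, the conditional probability of rejection is 1 if the velocity is bad, and otherwise one
  minus the index level, which the energy estimate bounds by a constant.
\<close>

lemma nuts_rejection_bound:
  fixes x :: "'a::euclidean_space"
  assumes h: "0 < h" "h \<le> 1" and \<alpha>: "\<alpha> \<le> real DIM('a)" and r: "0 \<le> r" "r \<le> real DIM('a)"
    and x: "x \<in> shell \<alpha>"
  shows "measure (nuts_selection_law h kmax x)
      (space (nuts_selection_law h kmax x) - good_event h x (velocity_event r x))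
    \<le> 4 * exp (- r\<^sup>2 / (8 * real DIM('a))) + h\<^sup>2 * max \<alpha> r + h ^ 4 * real DIM('a) / 4"
proof -
  let ?G = "std_gaussian :: 'a measure" and ?U = "uniform_measure lborel {0..1::real}"
  let ?Q = "(borel :: 'a measure) \<Otimes>\<^sub>M (count_space UNIV :: int set measure)"
  let ?E = "velocity_event r x" and ?O = "\<lambda>v. orbit_law h kmax (x, v)"
  define c where "c = h\<^sup>2 * max \<alpha> r + h ^ 4 * real DIM('a) / 4"
  have c: "0 \<le> c" using r by (simp add: c_def)
  interpret G: prob_space ?G by (rule prob_space_std_gaussian)
  interpret U: prob_space ?U by (rule prob_space_uniform_measure) simp_all
  interpret O: pmf_mixture_space ?G ?O ?Q Pair
    by unfold_locales (simp_all add: countable_kernel_sets_cong[OF countable_kernel_orbit_law[OF h]])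
  define S where "S = space (nuts_selection_law h kmax x) - good_event h x ?E"
  have law: "nuts_selection_law h kmax x = pmf_mixture ?G ?O ?Q Pair \<Otimes>\<^sub>M ?U"
    by (simp add: nuts_selection_law_def nuts_velocity_orbit_law[OF h])
  have "sets (pmf_mixture ?G ?O ?Q Pair \<Otimes>\<^sub>M ?U) = sets (?Q \<Otimes>\<^sub>M borel)"
    by (intro sets_pair_measure_cong O.sets_mixture) simp
  then have sets_law: "sets (nuts_selection_law h kmax x) = sets (?Q \<Otimes>\<^sub>M borel)"
    by (simp add: law)
  have S_sets: "S \<in> sets (?Q \<Otimes>\<^sub>M borel)"
    unfolding S_def sets_law[symmetric]
    using good_event_measurable[OF h velocity_event_measurable] sets_law by (intro sets.compl_sets) simp
  have S: "((v, I), w) \<in> S \<longleftrightarrow> \<not> (v \<in> ?E \<and> w \<le> index_level h x v I)" for v I w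
    using sets_eq_imp_space_eq[OF sets_law] by (auto simp: S_def good_event_def space_pair_measure)
  have section_meas: "(\<lambda>z. emeasure ?U (Pair z -` S)) \<in> borel_measurable ?Q"
    by (rule U.measurable_emeasure_Pair) (use S_sets in \<open>simp cong: sets_pair_measure_cong\<close>)
  have level: "emeasure ?U (Pair (v, I) -` S) \<le> indicator (- ?E) v + ennreal c"
    if "I \<in> set_pmf (?O v)" for v I
  proof (cases "v \<in> ?E")
    case False
    then show ?thesis
      using U.emeasure_le_1[of "Pair (v, I) -` S"] by (auto intro: order_trans)
  next
    case True
    have I: "finite I" "I \<noteq> {}" using set_orbit_law(2,3)[OF that] .
    let ?p = "index_level h x v I"
    have p: "0 \<le> ?p" "?p \<le> 1" using index_level_nonneg[OF I] index_level_le_1[OF I] .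
    have "1 - ?p \<le> c"
      using index_level_ge_near_shell[OF h velocity_event_bounds[OF x True] I] by (simp add: c_def)
    moreover have "Pair (v, I) -` S = {?p<..}"
      using True by (auto simp: S)
    moreover have "emeasure ?U {?p<..} = ennreal (1 - ?p)"
      by (rule emeasure_uniform_greaterThan[OF p])
    ultimately show ?thesis using True by (simp add: ennreal_leI)
  qed
  have "emeasure (nuts_selection_law h kmax x) S = (\<integral>\<^sup>+z. emeasure ?U (Pair z -` S) \<partial>pmf_mixture ?G ?O ?Q Pair)"
    unfolding law by (rule U.emeasure_pair_measure_alt) (use S_sets sets_law law in simp)
  also have "\<dots> = (\<integral>\<^sup>+v. \<integral>\<^sup>+I. emeasure ?U (Pair (v, I) -` S) \<partial>measure_pmf (?O v) \<partial>?G)"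
    by (rule O.nn_integral_mixture[OF section_meas])
  also have "\<dots> \<le> (\<integral>\<^sup>+v. indicator (- ?E) v + ennreal c \<partial>?G)"
  proof (rule nn_integral_mono)
    fix v
    have "(\<integral>\<^sup>+I. emeasure ?U (Pair (v, I) -` S) \<partial>measure_pmf (?O v)) \<le>
        (\<integral>\<^sup>+I. indicator (- ?E) v + ennreal c \<partial>measure_pmf (?O v))"
      by (rule nn_integral_mono_AE) (use level in \<open>auto simp: AE_measure_pmf_iff\<close>)
    then show "(\<integral>\<^sup>+I. emeasure ?U (Pair (v, I) -` S) \<partial>measure_pmf (?O v)) \<le> indicator (- ?E) v + ennreal c"
      by simp
  qed
  also have "\<dots> = emeasure ?G (- ?E) + ennreal c"
    by (subst nn_integral_add) (simp_all add: G.emeasure_space_1[simplified])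
  also have "\<dots> \<le> ennreal (4 * exp (- r\<^sup>2 / (8 * real DIM('a)))) + ennreal c"
    using x \<alpha> by (intro add_right_mono std_gaussian_velocity_event r) (auto simp: shell_def)
  also have "\<dots> = ennreal (4 * exp (- r\<^sup>2 / (8 * real DIM('a))) + c)"
    using c by (simp add: ennreal_plus)
  finally have "measure (nuts_selection_law h kmax x) S \<le> 4 * exp (- r\<^sup>2 / (8 * real DIM('a))) + c"
    using c unfolding measure_def by (intro enn2real_leI) auto
  then show ?thesis by (simp add: S_def c_def)
qed

theorem lemma5:
  fixes x :: "'a::euclidean_space" and \<alpha> r h \<delta> :: real and kmax :: nat
  assumes "0 \<le> \<alpha>" "\<alpha> \<le> real DIM('a)" "0 \<le> r" "r \<le> real DIM('a)"
    and "\<delta> = pi / 2 * (5 * max \<alpha> r / real DIM('a) + h\<^sup>2)"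
    and "0 < h" "h \<le> 1"
    and "{h * (2 ^ n - 1) | n::nat. True} \<inter> ({0<..<\<delta>} \<union> {pi - \<delta><..pi + \<delta>}) = {}"
    and "x \<in> shell \<alpha>"
  shows "(\<forall>kstar::nat. h * (2 ^ kstar - 1) \<in> {pi + \<delta><..<2 * pi - \<delta>} \<longrightarrow>
            (\<forall>k::nat. h * (2 ^ k - 1) \<in> {pi + \<delta><..<2 * pi - \<delta>} \<longrightarrow> k = kstar) \<and>
            nuts_follows_unif_hmc_on h kmax (min kstar kmax) x
              (good_event h x (velocity_event_sup \<alpha> r)) \<and>
            nuts_follows_unif_hmc_on h kmax (min kstar kmax) x
              (good_event h x (velocity_event r x)))
       \<and> measure (nuts_selection_law h kmax x)
           (space (nuts_selection_law h kmax x) - good_event h x (velocity_event r x))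
         \<le> 4 * exp (- r\<^sup>2 / (8 * real DIM('a))) + h\<^sup>2 * max \<alpha> r + h ^ 4 * real DIM('a) / 4"
proof (intro conjI allI impI)
  note h = \<open>0 < h\<close> \<open>h \<le> 1\<close>
  have "0 \<le> 5 * max \<alpha> r / real DIM('a)" using assms(1) by simp
  then have \<delta>: "0 < \<delta>"
    unfolding assms(5) using h by (intro mult_pos_pos add_nonneg_pos) auto
  let ?window = "{pi + \<delta><..<2 * pi - \<delta>}"
  have gap: "h * (2 ^ i - 1) \<le> pi - \<delta>" if "i < k" "h * (2 ^ k - 1) \<in> ?window" for i k :: nat
  proof -
    have "(2::real) * 2 ^ i \<le> 2 ^ k"
      using that(1) power_increasing[of "Suc i" k "2::real"] by simp
    then have "h * (2 * (2 ^ i - 1)) \<le> h * (2 ^ k - 1)"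
      using h by (intro mult_left_mono) auto
    then have "2 * (h * (2 ^ i - 1)) \<le> h * (2 ^ k - 1)" by (simp only: mult.left_commute)
    then have "h * (2 ^ i - 1) < pi + \<delta>" using that(2) \<delta> by auto
    moreover have "h * (2 ^ i - 1) \<notin> {pi - \<delta><..pi + \<delta>}" using assms(8) by blast
    ultimately show ?thesis by auto
  qed
  show unique: "k = kstar" if "h * (2 ^ kstar - 1) \<in> ?window" "h * (2 ^ k - 1) \<in> ?window" for k kstar :: nat
    using gap[of k kstar] gap[of kstar k] that \<delta> by (cases k kstar rule: linorder_cases) auto
  show follows: "nuts_follows_unif_hmc_on h kmax (min kstar kmax) x (good_event h x (velocity_event r x))"
    if kstar: "h * (2 ^ kstar - 1) \<in> ?window" for kstar
  proof (rule nuts_follows_unif_hmc_onI[OF h velocity_event_measurable])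
    fix v assume "v \<in> velocity_event r x"
    note bounds = velocity_event_bounds[OF assms(9) this]
    have "0 < kstar" using kstar \<delta> pi_gt_zero by (cases "kstar = 0") auto
    then show "orbit_law h kmax (x, v) = pmf_of_set (index_orbits0 (min kstar kmax))"
      using kstar gap[OF _ kstar] uturn_dichotomy[OF h bounds assms(5)]
      by (intro orbit_law_eq_uniform) auto
  qed
  show "nuts_follows_unif_hmc_on h kmax (min kstar kmax) x (good_event h x (velocity_event_sup \<alpha> r))"
    if kstar: "h * (2 ^ kstar - 1) \<in> ?window" for kstar
    using velocity_event_sup_subset[OF assms(9), of r]
    by (intro nuts_follows_unif_hmc_on_mono[OF follows[OF kstar]]) (auto simp: good_event_def)
  show "measure (nuts_selection_law h kmax x)
      (space (nuts_selection_law h kmax x) - good_event h x (velocity_event r x))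
    \<le> 4 * exp (- r\<^sup>2 / (8 * real DIM('a))) + h\<^sup>2 * max \<alpha> r + h ^ 4 * real DIM('a) / 4"
    by (rule nuts_rejection_bound) (use assms in auto)
qed

end
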